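(* Let $G$ be an infinite graph. The following are equivalent: (i) The $\Omega$-compactifications $\mathfrak FG$ and $\vartheta G$ of $G$ are topologically equivalent, i.e. there is a homeomorphism $\vartheta G\to\mathfrak FG$ fixing every point of $G$ and every end of $G$. (ii) $\mathcal C_{\mathfrak F}$ and $\mathcal C_{\mathcal U}$ are $\mathcal C$-equivalent. (iii) Every $\mathcal C_X$ ($X\in\mathcal X$) is finite. (iv) $\Omega=\mathfrak F=\mathcal U$, i.e. every element of $\mathfrak F$ and every element of $\mathcal U$ corresponds to an end of $G$.
   Context: $\mathcal X$: finite subsets of $V(G)$; $\mathcal C_X$: components of $G-X$ (discrete); $\phi_{X',X}$ sends a component of $G-X'$ to the component of $G-X$ containing it; $c_X(C)$ is the principal ultrafilter on $\mathcal C_X$ generated by $\{C\}$. $\mathcal U_X$: all ultrafilters on $\mathcal C_X$, Stone topology; $f_{X',X}(U')=\{\mathcal C\subseteq\mathcal C_X:\exists\mathcal C'\in U',\mathcal C\supseteq\phi_{X',X}[\mathcal C']\}$; $\mathcal U=\varprojlim\mathcal U_X$. $\mathcal C_X(Y)$: components of $G-X$ with neighbourhood exactly $Y$; $\mathrm{crit}(X)=\{Y\subseteq X:\mathcal C_X(Y)\text{ infinite}\}$; $\mathcal F_X(Y)$: sets $\mathcal C\subseteq\mathcal C_X$ containing a cofinite subset of $\mathcal C_X(Y)$; $\mathfrak F_X=\{c_X(C)\}\cup\{\mathcal F_X(Y):Y\in\mathrm{crit}(X)\}$ with topology generated by $\{\mathcal F:\mathcal C\in\mathcal F\}$; $\mathfrak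 f_{X',X}(c_{X'}(C'))=c_X(\phi_{X',X}(C'))$, $\mathfrak f_{X',X}(\mathcal F_{X'}(Y))=\mathcal F_X(Y)$ if $Y\subseteq X$, else $c_X(C)$ with $C$ the component of $G-X$ including $\bigcup\mathcal C_{X'}(Y)$; $\mathfrak F=\varprojlim\mathfrak F_X$. In $\mathcal U$ and $\mathfrak F$ each end $\omega$ is identified with $(c_X(C(X,\omega)))_X$, $C(X,\omega)$ the component of $G-X$ containing tails of the rays of $\omega$; $\Omega$ denotes these elements. $\vartheta G=G\cup\mathcal U$ and $\mathfrak FG=G\cup\mathfrak F$ ($G$ as 1-complex: edges copies of $[0,1]$, vertex neighbourhoods unions of half-open intervals at the vertex) with topologies generated by the 1-complex open sets and the sets $\bigcup\mathcal C\cup\mathring E(X,\bigcup\mathcal C)\cup\pi_X^{-1}(O)$ for $O$ open in $\mathcal U_X$ resp. $\mathfrak F_X$, $\mathcal C=c_X^{-1}(O)$, $\pi_X$ the projection, $\mathring E(X,\bigcup\mathcal C)$ the inner points of edges between $X$ and $\bigcup\mathcal C$. $\mathcal C_{\mathcal U}=\{(\mathcal U_X,c_X),f_{X',X}\}$, $\mathcal C_{\mathfrak F}=\{(\mathfrak F_X,c_X),\mathfrak f_{X',X}\}$. For compactifications, $(K,h)\le(K',h')$ iff there is a continuous $f:K'\to K$ with $f\circ h'=h$. For such systems, $\{(\alpha_X\text{-cpt}),\mathfrak a\}\le_{\mathcal C}\{(\delta_X\text{-cpt}),\mathfrak d\}$ iff for each $X$ some $f_X$ witnesses $(\alpha(\mathcal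 C_X),\alpha_X)\le(\delta(\mathcal C_X),\delta_X)$ and $f_X\circ\mathfrak d_{X',X}=\mathfrak a_{X',X}\circ f_{X'}$; $\mathcal C$-equivalent means $\le_{\mathcal C}$ in both directions. *)

theory Defs
  imports "HOL-Analysis.Analysis"
begin

record 'a graph =
  verts :: "'a set"
  edges :: "'a set set"

definition simple_graph :: "'a graph \<Rightarrow> bool" where
  "simple_graph G \<longleftrightarrow>
     (\<forall>e\<in>edges G. \<exists>u\<in>verts G. \<exists>v\<in>verts G. u \<noteq> v \<and> e = {u, v})"

definition fin_sets :: "'a graph \<Rightarrow> 'a set set" where
  "fin_sets G = {X. finite X \<and> X \<subseteq> verts G}"


section \<open>Components\<close>

text \<open>A component of \<open>G - X\<close> is represented by its vertex set.\<close>

definition adj_minus :: "'a graph \<Rightarrow> 'a set \<Rightarrow> ('a \<times> 'a) set" where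
  "adj_minus G X = {(u, v). u \<in> verts G - X \<and> v \<in> verts G - X \<and> {u, v} \<in> edges G}"

definition comps :: "'a graph \<Rightarrow> 'a set \<Rightarrow> 'a set set" where
  "comps G X = (verts G - X) // (adj_minus G X)\<^sup>*"

definition comp_map :: "'a graph \<Rightarrow> 'a set \<Rightarrow> 'a set \<Rightarrow> 'a set \<Rightarrow> 'a set" where
  "comp_map G X' X C' = (THE C. C \<in> comps G X \<and> C' \<subseteq> C)"

definition nbhd :: "'a graph \<Rightarrow> 'a set \<Rightarrow> 'a set" where
  "nbhd G C = {v \<in> verts G - C. \<exists>u\<in>C. {u, v} \<in> edges G}"

definition comps_at :: "'a graph \<Rightarrow> 'a set \<Rightarrow> 'a set \<Rightarrow> 'a set set" where
  "comps_at G X Y = {C \<in> comps G X. nbhd G C = Y}"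

definition crit :: "'a graph \<Rightarrow> 'a set \<Rightarrow> 'a set set" where
  "crit G X = {Y. Y \<subseteq> X \<and> infinite (comps_at G X Y)}"


section \<open>Filters on the sets of components\<close>

text \<open>Filters on a set are represented as sets of subsets, so that the points of both
  \<open>\<U>\<^sub>X\<close> and \<open>\<FF>\<^sub>X\<close> have type \<^typ>\<open>'a set set set\<close>.\<close>

definition ultrafilter_on :: "'b set \<Rightarrow> 'b set set \<Rightarrow> bool" where
  "ultrafilter_on S U \<longleftrightarrow>
     U \<subseteq> Pow S \<and> S \<in> U \<and> {} \<notin> U \<and>
     (\<forall>A\<in>U. \<forall>B\<in>U. A \<inter> B \<in> U) \<and>
     (\<forall>A\<in>U. \<forall>B. A \<subseteq> B \<and> B \<subseteq> S \<longrightarrow> B \<in> U) \<and>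
     (\<forall>A. A \<subseteq> S \<longrightarrow> A \<in> U \<or> S - A \<in> U)"

definition principal_uf :: "'a graph \<Rightarrow> 'a set \<Rightarrow> 'a set \<Rightarrow> 'a set set set" where
  "principal_uf G X C = {\<A>. \<A> \<subseteq> comps G X \<and> C \<in> \<A>}"

definition filter_topology ::
    "'a graph \<Rightarrow> 'a set \<Rightarrow> 'a set set set set \<Rightarrow> 'a set set set topology" where
  "filter_topology G X \<S> =
     topology_generated_by {{F \<in> \<S>. \<A> \<in> F} | \<A>. \<A> \<subseteq> comps G X}"

definition UX :: "'a graph \<Rightarrow> 'a set \<Rightarrow> 'a set set set set" where
  "UX G X = {U. ultrafilter_on (comps G X) U}"

definition U_map :: "'a graph \<Rightarrow> 'a set \<Rightarrow> 'a set \<Rightarrow> 'a set set set \<Rightarrow> 'a set set set" where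
  "U_map G X' X U' =
     {\<A>. \<A> \<subseteq> comps G X \<and> (\<exists>\<A>'\<in>U'. comp_map G X' X ` \<A>' \<subseteq> \<A>)}"

definition crit_filter :: "'a graph \<Rightarrow> 'a set \<Rightarrow> 'a set \<Rightarrow> 'a set set set" where
  "crit_filter G X Y =
     {\<A>. \<A> \<subseteq> comps G X \<and>
          (\<exists>\<B>. \<B> \<subseteq> comps_at G X Y \<and> finite (comps_at G X Y - \<B>) \<and> \<B> \<subseteq> \<A>)}"

definition FX :: "'a graph \<Rightarrow> 'a set \<Rightarrow> 'a set set set set" where
  "FX G X = principal_uf G X ` comps G X \<union> crit_filter G X ` crit G X"

text \<open>On \<open>\<FF>\<^sub>X'\<close> the two cases are exclusive, and \<open>C'\<close> respectively \<open>Y\<close> is determined by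
  the filter, because \<open>\<C>\<^sub>X'(Y)\<close> is infinite for critical \<open>Y\<close>.\<close>

definition F_map :: "'a graph \<Rightarrow> 'a set \<Rightarrow> 'a set \<Rightarrow> 'a set set set \<Rightarrow> 'a set set set" where
  "F_map G X' X F =
     (if \<exists>C'\<in>comps G X'. F = principal_uf G X' C'
      then principal_uf G X
             (comp_map G X' X (THE C'. C' \<in> comps G X' \<and> F = principal_uf G X' C'))
      else let Y = (THE Y. Y \<in> crit G X' \<and> F = crit_filter G X' Y) in
        if Y \<subseteq> X then crit_filter G X Y
        else principal_uf G X (THE C. C \<in> comps G X \<and> \<Union>(comps_at G X' Y) \<subseteq> C))"


section \<open>Inverse limits\<close>

text \<open>Only the underlying set of the limit is needed: the topologies on \<open>G \<union> \<U>\<close> and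
  \<open>G \<union> \<FF>\<close> are described through the projections \<open>\<xi> \<mapsto> \<xi> X\<close>.\<close>

type_synonym 'a limit_pt = "'a set \<Rightarrow> 'a set set set"

definition inv_limit ::
    "'a graph \<Rightarrow> ('a set \<Rightarrow> 'a set set set set) \<Rightarrow>
     ('a set \<Rightarrow> 'a set \<Rightarrow> 'a set set set \<Rightarrow> 'a set set set) \<Rightarrow> 'a limit_pt set" where
  "inv_limit G S f =
     {\<xi> \<in> (\<Pi>\<^sub>E X\<in>fin_sets G. S X).
        \<forall>X\<in>fin_sets G. \<forall>X'\<in>fin_sets G. X \<subseteq> X' \<longrightarrow> f X' X (\<xi> X') = \<xi> X}"

definition U_limit :: "'a graph \<Rightarrow> 'a limit_pt set" where
  "U_limit G = inv_limit G (UX G) (U_map G)"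

definition F_limit :: "'a graph \<Rightarrow> 'a limit_pt set" where
  "F_limit G = inv_limit G (FX G) (F_map G)"


section \<open>Ends\<close>

definition ray :: "'a graph \<Rightarrow> (nat \<Rightarrow> 'a) \<Rightarrow> bool" where
  "ray G r \<longleftrightarrow> inj r \<and> range r \<subseteq> verts G \<and> (\<forall>n. {r n, r (Suc n)} \<in> edges G)"

definition has_tail_in :: "(nat \<Rightarrow> 'a) \<Rightarrow> 'a set \<Rightarrow> bool" where
  "has_tail_in r C \<longleftrightarrow> (\<exists>n. r ` {n..} \<subseteq> C)"

definition ray_equiv :: "'a graph \<Rightarrow> ((nat \<Rightarrow> 'a) \<times> (nat \<Rightarrow> 'a)) set" where
  "ray_equiv G =
     {(r, s). ray G r \<and> ray G s \<and>
        (\<forall>X\<in>fin_sets G. \<exists>C\<in>comps G X. has_tail_in r C \<and> has_tail_in s C)}"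

definition graph_ends :: "'a graph \<Rightarrow> (nat \<Rightarrow> 'a) set set" where
  "graph_ends G = {r. ray G r} // ray_equiv G"

definition end_comp :: "'a graph \<Rightarrow> 'a set \<Rightarrow> (nat \<Rightarrow> 'a) set \<Rightarrow> 'a set" where
  "end_comp G X \<omega> = (THE C. C \<in> comps G X \<and> (\<forall>r\<in>\<omega>. has_tail_in r C))"

definition end_pt :: "'a graph \<Rightarrow> (nat \<Rightarrow> 'a) set \<Rightarrow> 'a limit_pt" where
  "end_pt G \<omega> = (\<lambda>X\<in>fin_sets G. principal_uf G X (end_comp G X \<omega>))"

definition Omega :: "'a graph \<Rightarrow> 'a limit_pt set" where
  "Omega G = end_pt G ` graph_ends G"


section \<open>The 1-complex of a graph and its extensions\<close>

text \<open>Points of the 1-complex are given by barycentric coordinates: the point at parameter \<open>t\<close>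
  on the edge from \<open>u\<close> to \<open>v\<close> has weight \<open>1 - t\<close> at \<open>u\<close> and \<open>t\<close> at \<open>v\<close>.  Thus no orientation
  of the edges has to be chosen: \<open>edge_pt u v t = edge_pt v u (1 - t)\<close>, and
  \<open>edge_pt u v 0 = vertex_pt u\<close>.\<close>

definition vertex_pt :: "'a \<Rightarrow> 'a \<Rightarrow> real" where
  "vertex_pt u = (\<lambda>w. if w = u then 1 else 0)"

definition edge_pt :: "'a \<Rightarrow> 'a \<Rightarrow> real \<Rightarrow> 'a \<Rightarrow> real" where
  "edge_pt u v t = (\<lambda>w. if w = u then 1 - t else if w = v then t else 0)"

definition inner_pts :: "'a graph \<Rightarrow> 'a set \<Rightarrow> 'a set \<Rightarrow> ('a \<Rightarrow> real) set" where
  "inner_pts G A B =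
     {edge_pt u v t | u v t. u \<in> A \<and> v \<in> B \<and> {u, v} \<in> edges G \<and> 0 < t \<and> t < 1}"

definition induced_pts :: "'a graph \<Rightarrow> 'a set \<Rightarrow> ('a \<Rightarrow> real) set" where
  "induced_pts G A = vertex_pt ` A \<union> inner_pts G A A"

definition complex_pts :: "'a graph \<Rightarrow> ('a \<Rightarrow> real) set" where
  "complex_pts G = induced_pts G (verts G)"

definition vertex_star :: "'a graph \<Rightarrow> 'a \<Rightarrow> ('a \<Rightarrow> real) \<Rightarrow> ('a \<Rightarrow> real) set" where
  "vertex_star G u \<epsilon> =
     {vertex_pt u} \<union> {edge_pt u v t | v t. {u, v} \<in> edges G \<and> 0 \<le> t \<and> t < \<epsilon> v}"

definition one_complex :: "'a graph \<Rightarrow> ('a \<Rightarrow> real) topology" where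
  "one_complex G = topology_generated_by
     ({edge_pt u v ` {a<..<b} | u v a b. {u, v} \<in> edges G \<and> 0 \<le> a \<and> a < b \<and> b \<le> 1} \<union>
      {vertex_star G u \<epsilon> | u \<epsilon>. u \<in> verts G \<and> (\<forall>v. 0 < \<epsilon> v \<and> \<epsilon> v \<le> 1)})"

type_synonym 'a ext_pt = "('a \<Rightarrow> real) + 'a limit_pt"

definition limit_nbhd ::
    "'a graph \<Rightarrow> 'a limit_pt set \<Rightarrow> 'a set \<Rightarrow> 'a set set set set \<Rightarrow> 'a ext_pt set" where
  "limit_nbhd G L X Q =
     (let W = \<Union>{C \<in> comps G X. principal_uf G X C \<in> Q} in
      Inl ` (induced_pts G W \<union> inner_pts G X W) \<union> Inr ` {\<xi> \<in> L. \<xi> X \<in> Q})"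

definition ext_topology ::
    "'a graph \<Rightarrow> ('a set \<Rightarrow> 'a set set set topology) \<Rightarrow> 'a limit_pt set \<Rightarrow>
     'a ext_pt topology" where
  "ext_topology G T L = topology_generated_by
     ({Inl ` Q | Q. openin (one_complex G) Q} \<union>
      {limit_nbhd G L X Q | X Q. X \<in> fin_sets G \<and> openin (T X) Q})"

definition UX_top :: "'a graph \<Rightarrow> 'a set \<Rightarrow> 'a set set set topology" where
  "UX_top G X = filter_topology G X (UX G X)"

definition FX_top :: "'a graph \<Rightarrow> 'a set \<Rightarrow> 'a set set set topology" where
  "FX_top G X = filter_topology G X (FX G X)"

definition theta_G :: "'a graph \<Rightarrow> 'a ext_pt topology" where
  "theta_G G = ext_topology G (UX_top G) (U_limit G)"

definition F_G :: "'a graph \<Rightarrow> 'a ext_pt topology" where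
  "F_G G = ext_topology G (FX_top G) (F_limit G)"

definition Omega_cpt_equivalent ::
    "'a graph \<Rightarrow> 'a ext_pt topology \<Rightarrow> 'a ext_pt topology \<Rightarrow> bool" where
  "Omega_cpt_equivalent G K K' \<longleftrightarrow>
     (\<exists>h. homeomorphic_map K K' h \<and>
          (\<forall>p\<in>complex_pts G. h (Inl p) = Inl p) \<and>
          (\<forall>\<xi>\<in>Omega G. h (Inr \<xi>) = Inr \<xi>))"


section \<open>Systems of compactifications of the component spaces\<close>

text \<open>\<open>cpt_le_via D (K, h) (K', h') f\<close>: the map \<open>f\<close> witnesses \<open>(K, h) \<le> (K', h')\<close> for
  compactifications of the discrete space \<open>D\<close>.\<close>

fun cpt_le_via ::
    "'d set \<Rightarrow> 'p topology \<times> ('d \<Rightarrow> 'p) \<Rightarrow> 'q topology \<times> ('d \<Rightarrow> 'q) \<Rightarrow> ('q \<Rightarrow> 'p) \<Rightarrow> bool"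
  where
  "cpt_le_via D (K, h) (K', h') f \<longleftrightarrow> continuous_map K' K f \<and> (\<forall>x\<in>D. f (h' x) = h x)"

text \<open>A system consists of the spaces, the embeddings of the \<open>\<C>\<^sub>X\<close> and the bonding maps
  (indexed first by the larger set \<open>X'\<close>, then by \<open>X\<close>).\<close>

type_synonym ('a, 'p) cpt_system =
  "('a set \<Rightarrow> 'p topology) \<times> ('a set \<Rightarrow> 'a set \<Rightarrow> 'p) \<times> ('a set \<Rightarrow> 'a set \<Rightarrow> 'p \<Rightarrow> 'p)"

fun sys_le :: "'a graph \<Rightarrow> ('a, 'p) cpt_system \<Rightarrow> ('a, 'q) cpt_system \<Rightarrow> bool" where
  "sys_le G (A, \<alpha>, a) (D, \<delta>, d) \<longleftrightarrow>
     (\<exists>f. (\<forall>X\<in>fin_sets G. cpt_le_via (comps G X) (A X, \<alpha> X) (D X, \<delta> X) (f X)) \<and>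
          (\<forall>X\<in>fin_sets G. \<forall>X'\<in>fin_sets G. X \<subseteq> X' \<longrightarrow>
             (\<forall>x\<in>topspace (D X'). f X (d X' X x) = a X' X (f X' x))))"

definition sys_equivalent ::
    "'a graph \<Rightarrow> ('a, 'p) cpt_system \<Rightarrow> ('a, 'q) cpt_system \<Rightarrow> bool" where
  "sys_equivalent G S S' \<longleftrightarrow> sys_le G S S' \<and> sys_le G S' S"

definition U_system :: "'a graph \<Rightarrow> ('a, 'a set set set) cpt_system" where
  "U_system G = (UX_top G, principal_uf G, U_map G)"

definition F_system :: "'a graph \<Rightarrow> ('a, 'a set set set) cpt_system" where
  "F_system G = (FX_top G, principal_uf G, F_map G)"

end

theory Submission
  imports Defs
begin

text \<open>
  If every \<open>\<C>\<^sub>X\<close> is finite, then \<open>\<U>\<^sub>X\<close> and \<open>\<FF>\<^sub>X\<close> consist of the same principal filters, so the two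
  systems coincide; the points of the limit are directions, and every direction \<open>f\<close> comes from an
  end (Diestel and Kuehn).  For the latter, let \<open>U\<close> be the set of vertices that no finite set
  separates from \<open>f\<close>.  If \<open>U\<close> is infinite, a ray is obtained by joining vertices of \<open>U\<close> by paths
  avoiding everything used before.  If \<open>U\<close> is finite, there is a sequence of finite sets \<open>X\<^sub>n\<close> whose
  components \<open>f(X\<^sub>n)\<close> have neighbourhoods disjoint outside \<open>U\<close>, hence empty intersection, and a ray
  passing through the \<open>f(X\<^sub>n)\<close> belongs to \<open>f\<close>.

  If some \<open>\<C>\<^sub>X\<close> is infinite, then by the pigeonhole principle infinitely many components have the
  same neighbourhood \<open>Y\<close>, and \<open>Y\<close> determines a point of \<open>\<FF>\<close> that is not an end.  Every neighbourhood
  of this point contains almost all components in \<open>\<C>\<^sub>Y(Y)\<close>, whereas a point of \<open>\<U>\<close> is an ultrafilter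
  on \<open>\<C>\<^sub>Y\<close> and so misses one of two infinite halves of \<open>\<C>\<^sub>Y(Y)\<close>.  No map that is the
  identity on \<open>G\<close>, respectively on \<open>\<C>\<^sub>Y\<close>, can therefore match them.
\<close>

section \<open>Components\<close>

text \<open>For \<open>v\<close> in \<open>X\<close> or outside the graph the class is just
  \<open>{v}\<close>, which is not a component; hence the side conditions in
  \<open>comp_of_in_comps\<close>.\<close>

definition comp_of :: "'a graph \<Rightarrow> 'a set \<Rightarrow> 'a \<Rightarrow> 'a set" where
  "comp_of G X v = (adj_minus G X)\<^sup>* `` {v}"

lemma sym_adj_minus: "sym (adj_minus G X)"
  by (auto simp: sym_def adj_minus_def insert_commute)

lemma adj_minus_mono: "X \<subseteq> X' \<Longrightarrow> adj_minus G X' \<subseteq> adj_minus G X"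
  by (auto simp: adj_minus_def)

lemma comps_iff: "C \<in> comps G X \<longleftrightarrow> (\<exists>v\<in>verts G - X. C = comp_of G X v)"
  by (auto simp: comps_def comp_of_def quotient_def)

lemma comp_of_self: "v \<in> comp_of G X v"
  by (simp add: comp_of_def)

lemma comp_of_eq: "u \<in> comp_of G X v \<Longrightarrow> comp_of G X u = comp_of G X v"
  unfolding comp_of_def
  by (auto intro: rtrancl_trans dest: symD[OF sym_rtrancl[OF sym_adj_minus]])

lemma comp_of_in_comps: "v \<in> verts G \<Longrightarrow> v \<notin> X \<Longrightarrow> comp_of G X v \<in> comps G X"
  by (auto simp: comps_iff)

lemma comp_eq_comp_of: "C \<in> comps G X \<Longrightarrow> v \<in> C \<Longrightarrow> C = comp_of G X v"
  by (auto simp: comps_iff comp_of_eq)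

lemma comp_nonempty: "C \<in> comps G X \<Longrightarrow> \<exists>v. v \<in> C"
  by (auto simp: comps_iff intro: comp_of_self)

lemma comp_of_subset:
  assumes "v \<in> verts G" "v \<notin> X" shows "comp_of G X v \<subseteq> verts G - X"
proof
  fix u assume "u \<in> comp_of G X v"
  then have "(v, u) \<in> (adj_minus G X)\<^sup>*" by (simp add: comp_of_def)
  then show "u \<in> verts G - X"
    by (induction rule: rtrancl_induct) (use assms in \<open>auto simp: adj_minus_def\<close>)
qed

lemma comp_subset: "C \<in> comps G X \<Longrightarrow> C \<subseteq> verts G - X"
  using comp_of_subset by (fastforce simp: comps_iff)

lemma comps_eqI: "C \<in> comps G X \<Longrightarrow> D \<in> comps G X \<Longrightarrow> v \<in> C \<Longrightarrow> v \<in> D \<Longrightarrow> C = D"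
  by (metis comp_eq_comp_of)

lemma comp_of_mono: "X \<subseteq> X' \<Longrightarrow> comp_of G X' v \<subseteq> comp_of G X v"
  unfolding comp_of_def using rtrancl_mono[OF adj_minus_mono] by blast

lemma comp_adjacent:
  "C \<in> comps G X \<Longrightarrow> u \<in> C \<Longrightarrow> (u, w) \<in> adj_minus G X \<Longrightarrow> w \<in> C"
  unfolding comp_of_def comps_iff by (auto intro: rtrancl_into_rtrancl)

lemma comp_rtrancl:
  "C \<in> comps G X \<Longrightarrow> u \<in> C \<Longrightarrow> (u, w) \<in> (adj_minus G X)\<^sup>* \<longleftrightarrow> w \<in> C"
  by (metis Image_singleton_iff comp_eq_comp_of comp_of_def)

lemma nbhd_comp_subset: "C \<in> comps G X \<Longrightarrow> nbhd G C \<subseteq> X"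
  using comp_adjacent comp_subset by (fastforce simp: nbhd_def adj_minus_def)

text \<open>A walk inside \<open>C\<close> avoids \<open>Z\<close> and is therefore a walk in
  \<open>G - Z\<close>. Here \<open>X\<close> and \<open>Z\<close> are arbitrary, so components for
  incomparable sets can be compared.\<close>

lemma comp_subset_comp_of:
  assumes "C \<in> comps G X" "v \<in> C" "C \<inter> Z = {}"
  shows "C \<subseteq> comp_of G Z v"
proof
  fix u assume "u \<in> C"
  then have "(v, u) \<in> (adj_minus G X)\<^sup>*" using assms comp_rtrancl by metis
  then have "u \<in> C \<and> (v, u) \<in> (adj_minus G Z)\<^sup>*"
  proof (induction rule: rtrancl_induct)
    case (step y z)
    then have "z \<in> C" using assms comp_adjacent by metis
    moreover have "(y, z) \<in> adj_minus G Z"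
      using step \<open>z \<in> C\<close> assms(3) by (auto simp: adj_minus_def)
    ultimately show ?case using step by (meson rtrancl.rtrancl_into_rtrancl)
  qed (use assms in auto)
  then show "u \<in> comp_of G Z v" by (simp add: comp_of_def)
qed

lemma comp_subset_comp:
  assumes "C \<in> comps G X" "D \<in> comps G Z" "C \<inter> Z = {}" "v \<in> C" "v \<in> D"
  shows "C \<subseteq> D"
  using comp_subset_comp_of[of C G X v Z] comp_eq_comp_of[of D G Z v] assms by simp

text \<open>\<open>C\<close> stays connected in \<open>G - Z\<close>, and a walk in
  \<open>G - Z\<close> cannot leave \<open>C\<close>, since its first vertex outside would lie in
  \<open>nbhd G C\<close>.\<close>

lemma comp_transfer:
  assumes C: "C \<in> comps G X" and Z: "C \<inter> Z = {}" "nbhd G C \<subseteq> Z"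
  shows "C \<in> comps G Z"
proof -
  obtain v where v: "v \<in> C" using comp_nonempty[OF C] by blast
  have vV: "v \<in> verts G - Z" using comp_subset[OF C] v Z by auto
  have "comp_of G Z v \<subseteq> C"
  proof
    fix u assume "u \<in> comp_of G Z v"
    then have "(v, u) \<in> (adj_minus G Z)\<^sup>*" by (simp add: comp_of_def)
    then show "u \<in> C"
    proof (induction rule: rtrancl_induct)
      case (step y z)
      then show ?case using Z by (auto simp: adj_minus_def nbhd_def)
    qed (rule v)
  qed
  with comp_subset_comp_of[OF C v Z(1)] vV show ?thesis by (auto simp: comps_iff)
qed

text \<open>This gives meaning to the \<open>THE\<close> in \<open>comp_map\<close>.\<close>

lemma comps_super_ex:
  assumes "C' \<in> comps G X'" "X \<subseteq> X'"
  shows "\<exists>!C. C \<in> comps G X \<and> C' \<subseteq> C"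
proof -
  obtain v where v: "v \<in> verts G - X'" "C' = comp_of G X' v" using assms by (auto simp: comps_iff)
  show ?thesis
  proof (rule ex1I[of _ "comp_of G X v"])
    show "comp_of G X v \<in> comps G X \<and> C' \<subseteq> comp_of G X v"
      using v assms comp_of_mono[OF assms(2)] by (auto intro: comp_of_in_comps)
    show "D = comp_of G X v" if "D \<in> comps G X \<and> C' \<subseteq> D" for D
      using that v(2) comp_eq_comp_of[of D G X v] comp_of_self[of v G X'] by blast
  qed
qed

lemma comp_map_eq:
  assumes "C' \<in> comps G X'" "X \<subseteq> X'" "C \<in> comps G X" "v \<in> C'" "v \<in> C"
  shows "comp_map G X' X C' = C"
proof -
  have "C' \<subseteq> C" using comp_subset_comp[OF assms(1,3)] assms comp_subset by blast
  then show ?thesis unfolding comp_map_def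
    using comps_super_ex[OF assms(1,2)] assms(3) by (metis (no_types, lifting) the1_equality)
qed

lemma comps_at_comp: "C \<in> comps_at G X Y \<Longrightarrow> C \<in> comps G X"
  by (simp add: comps_at_def)

lemma comps_at_transfer:
  "C \<in> comps_at G X Y \<Longrightarrow> C \<inter> Z = {} \<Longrightarrow> Y \<subseteq> Z \<Longrightarrow> C \<in> comps_at G Z Y"
  by (auto simp: comps_at_def intro: comp_transfer)

text \<open>Components are disjoint, so each vertex of \<open>Z\<close> accounts for at most one of
  them.\<close>

lemma finite_comps_meeting:
  assumes "finite Z" shows "finite {C \<in> comps G X. C \<inter> Z \<noteq> {}}"
proof -
  have "{C \<in> comps G X. C \<inter> Z \<noteq> {}} \<subseteq> comp_of G X ` Z"
    using comp_eq_comp_of by fastforce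
  then show ?thesis using assms finite_surj by blast
qed


section \<open>Ends and directions\<close>

text \<open>The combinatorial form of a point of the inverse limit all of whose coordinates are
  principal filters.\<close>

definition direction :: "'a graph \<Rightarrow> ('a set \<Rightarrow> 'a set) \<Rightarrow> bool" where
  "direction G f \<longleftrightarrow> (\<forall>X\<in>fin_sets G. f X \<in> comps G X) \<and>
     (\<forall>X\<in>fin_sets G. \<forall>X'\<in>fin_sets G. X \<subseteq> X' \<longrightarrow> f X' \<subseteq> f X)"

section \<open>Walks and the rays extracted from them\<close>

lemma trancl_path:
  assumes "(a, b) \<in> R\<^sup>+"
  shows "\<exists>Q. Q \<noteq> [] \<and> last Q = b \<and> successively (\<lambda>u v. (u, v) \<in> R) (a # Q)"
  using assms
proof (induction rule: trancl_induct)
  case (base y)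
  then show ?case by (intro exI[of _ "[y]"]) simp
next
  case (step y z)
  then obtain Q where "Q \<noteq> []" "last Q = y" "successively (\<lambda>u v. (u, v) \<in> R) (a # Q)" by blast
  then show ?case using step(2)
    by (intro exI[of _ "Q @ [z]"])
      (simp add: successively_append_iff flip: append_Cons)
qed

lemma successively_adj_comp:
  assumes "C \<in> comps G X" "a \<in> C" "successively (\<lambda>u v. (u, v) \<in> adj_minus G X) (a # Q)"
  shows "set Q \<subseteq> C"
  using assms(2,3)
proof (induction Q arbitrary: a)
  case (Cons b Q)
  then have "b \<in> C" using assms(1) comp_adjacent by auto
  then show ?case using Cons by auto
qed simp

lemma comp_path:
  assumes "C \<in> comps G X" "a \<in> C" "b \<in> C" "a \<noteq> b"
  shows "\<exists>Q. Q \<noteq> [] \<and> last Q = b \<and> set Q \<subseteq> C \<and>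
             successively (\<lambda>u v. {u, v} \<in> edges G) (a # Q)"
proof -
  have "(a, b) \<in> (adj_minus G X)\<^sup>+"
    using assms comp_rtrancl by (metis rtranclD)
  then obtain Q where Q: "Q \<noteq> []" "last Q = b"
      "successively (\<lambda>u v. (u, v) \<in> adj_minus G X) (a # Q)"
    using trancl_path[of a b "adj_minus G X"] by blast
  then show ?thesis using successively_adj_comp[OF assms(1,2) Q(3)]
    by (intro exI[of _ Q]) (auto elim!: successively_mono simp: adj_minus_def)
qed

text \<open>Loop erasure: from each visited vertex, jump to its last visit and make one step.\<close>

lemma ray_of_walk:
  fixes w :: "nat \<Rightarrow> 'a"
  assumes V: "range w \<subseteq> verts G" and E: "\<And>n. {w n, w (Suc n)} \<in> edges G"
    and fin: "\<And>x. finite {i. w i = x}"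
  shows "\<exists>r t. ray G r \<and> (\<forall>k. r k = w (t k) \<and> k \<le> t k)"
proof -
  define m where "m i = Max {j. w j = w i}" for i
  have m: "w (m i) = w i" "\<And>j. w j = w i \<Longrightarrow> j \<le> m i" for i
  proof -
    have "m i \<in> {j. w j = w i}" unfolding m_def by (rule Max_in) (use fin in auto)
    then show "w (m i) = w i" by simp
    show "\<And>j. w j = w i \<Longrightarrow> j \<le> m i" unfolding m_def using fin by auto
  qed
  define t where "t = rec_nat (m 0) (\<lambda>_ i. m (Suc i))"
  have t: "t 0 = m 0" "t (Suc k) = m (Suc (t k))" for k by (simp_all add: t_def)
  \<comment> \<open>Each \<open>t k\<close> is the last visit to its vertex, so the vertices
    \<open>w (t k)\<close> are distinct.\<close>
  have last: "j \<le> t k" if "w j = w (t k)" for j k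
    using that by (cases k) (simp_all add: t m)
  have "strict_mono t"
    using m(2)[OF refl] by (simp add: strict_mono_Suc_iff t flip: Suc_le_eq)
  have "inj (\<lambda>k. w (t k))"
    by (rule injI) (metis last order_antisym strict_mono_eq[OF \<open>strict_mono t\<close>])
  then have "ray G (\<lambda>k. w (t k))" using V E by (auto simp: ray_def t m(1))
  then show ?thesis using \<open>strict_mono t\<close> strict_mono_imp_increasing by blast
qed

lemma ray_of_paths:
  fixes Q :: "nat \<Rightarrow> 'a list"
  assumes ne: "\<And>n. Q n \<noteq> []" and last: "\<And>n. last (Q n) = v (Suc n)"
    and path: "\<And>n. successively (\<lambda>u v. {u, v} \<in> edges G) (v n # Q n)"
    and V: "\<And>n. set (Q n) \<subseteq> verts G" "v 0 \<in> verts G"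
    and fin: "\<And>x. \<exists>N. \<forall>n\<ge>N. x \<notin> set (Q n)"
  shows "\<exists>r. ray G r \<and> (\<forall>N. \<exists>k. \<forall>i\<ge>k. r i \<in> (\<Union>n\<in>{N..}. set (Q n)))"
proof -
  \<comment> \<open>\<open>W n\<close> joins the first \<open>n\<close> paths. Since
    \<open>Q n\<close> omits its initial vertex \<open>v n\<close>, concatenation does not double
    the joints.\<close>
  define W where "W = rec_nat [v 0] (\<lambda>n xs. xs @ Q n)"
  have W: "W 0 = [v 0]" "W (Suc n) = W n @ Q n" for n by (simp_all add: W_def)
  have len: "n < length (W n)" for n
  proof (induction n)
    case (Suc n)
    moreover have "length (Q n) > 0" using ne by blast
    ultimately show ?case unfolding W length_append by linarith
  qed (simp add: W)
  have lastW: "W n \<noteq> [] \<and> last (W n) = v n" for n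
    by (induction n) (simp_all add: W ne last)
  have succW: "successively (\<lambda>u v. {u, v} \<in> edges G) (W n)" for n
  proof (induction n)
    case (Suc n)
    then show ?case using path[of n] lastW[of n] ne[of n]
      by (cases "Q n") (auto simp: W successively_append_iff)
  qed (simp add: W)
  have setW: "set (W n) \<subseteq> verts G" for n
    by (induction n) (use V in \<open>auto simp: W\<close>)
  have pre: "\<exists>ys. W (n + d) = W n @ ys \<and> set ys \<subseteq> (\<Union>n\<in>{n..}. set (Q n))" for n d
  proof (induction d)
    case (Suc d)
    then obtain ys where "W (n + d) = W n @ ys" "set ys \<subseteq> (\<Union>n\<in>{n..}. set (Q n))" by blast
    moreover have "set (Q (n + d)) \<subseteq> (\<Union>n\<in>{n..}. set (Q n))" by (rule UN_upper) simp
    ultimately show ?case by (intro exI[of _ "ys @ Q (n + d)"]) (simp add: W)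
  qed simp
  have nth: "W m ! i = W n ! i" if "n \<le> m" "i < length (W n)" for m n i
    using pre[of n "m - n"] that by (auto simp: nth_append)
  define w where "w i = W i ! i" for i
  have w: "w i = W n ! i" if "i < length (W n)" for i n
    unfolding w_def using nth[of n i i] nth[of i n i] that len by (metis nat_le_linear)
  \<comment> \<open>Positions beyond \<open>W N\<close> come from paths with index at least
    \<open>N\<close>; so a vertex on finitely many paths is visited finitely often, and loop erasure
    applies.\<close>
  have tail: "w i \<in> (\<Union>n\<in>{N..}. set (Q n))" if i: "i \<ge> length (W N)" for i N
  proof -
    obtain ys where ys: "W (N + i) = W N @ ys" "set ys \<subseteq> (\<Union>n\<in>{N..}. set (Q n))"
      using pre by blast
    have *: "i < length (W (N + i))" using len[of "N + i"] by simp
    then have "w i = ys ! (i - length (W N))" "i - length (W N) < length ys"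
      using w[OF *] ys i by (auto simp: nth_append)
    then show ?thesis using ys(2) nth_mem by fastforce
  qed
  have "{w n, w (Suc n)} \<in> edges G" for n
  proof -
    have "Suc n < length (W (Suc n))" by (rule len)
    then show ?thesis using succW[of "Suc n"] w[of _ "Suc n"]
      by (simp add: successively_conv_nth)
  qed
  moreover have "range w \<subseteq> verts G"
    using setW len by (auto simp: w_def) (metis nth_mem subsetD)
  moreover have "finite {i. w i = x}" for x
  proof -
    obtain N where "\<forall>n\<ge>N. x \<notin> set (Q n)" using fin by blast
    then have "{i. w i = x} \<subseteq> {..<length (W N)}" using tail[of N] by (force simp: not_le[symmetric])
    then show ?thesis using finite_subset by blast
  qed
  ultimately obtain r t where "ray G r" "\<And>k. r k = w (t k)" "\<And>k. k \<le> t k"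
    using ray_of_walk by metis
  then show ?thesis using tail by (metis le_trans)
qed

section \<open>Every direction is induced by a ray\<close>

lemma directionD:
  assumes "direction G f" "X \<in> fin_sets G"
  shows "f X \<in> comps G X" "f X \<subseteq> verts G - X" "\<exists>v. v \<in> f X"
proof -
  show C: "f X \<in> comps G X" using assms by (simp add: direction_def)
  show "f X \<subseteq> verts G - X" "\<exists>v. v \<in> f X" using comp_subset[OF C] comp_nonempty[OF C] .
qed

lemma direction_mono:
  "direction G f \<Longrightarrow> X \<in> fin_sets G \<Longrightarrow> X' \<in> fin_sets G \<Longrightarrow> X \<subseteq> X' \<Longrightarrow> f X' \<subseteq> f X"
  by (auto simp: direction_def)

lemma fin_sets_Un: "X \<in> fin_sets G \<Longrightarrow> Z \<in> fin_sets G \<Longrightarrow> X \<union> Z \<in> fin_sets G"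
  by (auto simp: fin_sets_def)

lemma ray_of_direction_paths:
  fixes Q :: "nat \<Rightarrow> 'a list"
  assumes f: "direction G f"
    and ne: "\<And>n. Q n \<noteq> []" and last: "\<And>n. last (Q n) = v (Suc n)"
    and path: "\<And>n. successively (\<lambda>u v. {u, v} \<in> edges G) (v n # Q n)"
    and V: "\<And>n. set (Q n) \<subseteq> verts G" "v 0 \<in> verts G"
    and ev: "\<And>X. X \<in> fin_sets G \<Longrightarrow> \<exists>N. \<forall>n\<ge>N. set (Q n) \<subseteq> f X"
  shows "\<exists>r. ray G r \<and> (\<forall>X\<in>fin_sets G. has_tail_in r (f X))"
proof -
  \<comment> \<open>Late paths run in \<open>f {x}\<close>, which misses \<open>x\<close>.\<close>
  have "\<exists>N. \<forall>n\<ge>N. x \<notin> set (Q n)" for x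
  proof (cases "x \<in> verts G")
    case True
    then have "{x} \<in> fin_sets G" by (simp add: fin_sets_def)
    then show ?thesis using ev directionD(2)[OF f] by blast
  qed (use V in blast)
  then obtain r where r: "ray G r" "\<And>N. \<exists>k. \<forall>i\<ge>k. r i \<in> (\<Union>n\<in>{N..}. set (Q n))"
    using ray_of_paths[OF ne last path V] by blast
  have "has_tail_in r (f X)" if X: "X \<in> fin_sets G" for X
  proof -
    obtain N where N: "\<forall>n\<ge>N. set (Q n) \<subseteq> f X" using ev[OF X] by blast
    obtain k where "\<forall>i\<ge>k. r i \<in> (\<Union>n\<in>{N..}. set (Q n))" using r by blast
    then have "r ` {k..} \<subseteq> f X" using N by fastforce
    then show ?thesis by (auto simp: has_tail_in_def)
  qed
  then show ?thesis using r by blast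
qed

text \<open>For a direction given by an end, these are the vertices dominating that end.\<close>

definition dominating :: "'a graph \<Rightarrow> ('a set \<Rightarrow> 'a set) \<Rightarrow> 'a set" where
  "dominating G f = {v \<in> verts G. \<forall>X\<in>fin_sets G. v \<in> X \<or> v \<in> f X}"

text \<open>Each path avoids what was used before its initial vertex, so a finite \<open>Z\<close>
  meets only finitely many paths. A joint outside \<open>Z\<close> dominates and hence lies in
  \<open>f Z\<close>, and a path from it that avoids \<open>Z\<close> stays there.\<close>

lemma direction_ray_infinite_dominating:
  assumes f: "direction G f" and inf: "infinite (dominating G f)"
  shows "\<exists>r. ray G r \<and> (\<forall>X\<in>fin_sets G. has_tail_in r (f X))"
proof -
  let ?U = "dominating G f"
  let ?E = "\<lambda>u v. {u, v} \<in> edges G"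
  \<comment> \<open>A state consists of the current dominating vertex and a finite set of used
    vertices. In \<open>R\<close> the endpoint \<open>v'\<close> is withheld from that set, because
    the next path starts there and needs \<open>v'\<close> in \<open>f X'\<close>.\<close>
  define P where "P = (\<lambda>(v, X). v \<in> ?U \<and> X \<in> fin_sets G \<and> v \<notin> X)"
  define R where "R = (\<lambda>(v, X) (v', X'). \<exists>Q. Q \<noteq> [] \<and> last Q = v' \<and> successively ?E (v # Q) \<and>
      set Q \<subseteq> verts G - X \<and> X' = X \<union> {v} \<union> (set Q - {v'}))"
  have step: "\<exists>b. P b \<and> R a b" if Pa: "P a" for a
  proof -
    obtain v X where a: "a = (v, X)" "v \<in> ?U" "X \<in> fin_sets G" "v \<notin> X"
      using Pa by (auto simp: P_def split: prod.splits)
    then have "infinite (?U - (X \<union> {v}))" using inf by (simp add: fin_sets_def)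
    then obtain v' where v': "v' \<in> ?U" "v' \<notin> X" "v' \<noteq> v" by (metis DiffD1 DiffD2 UnI1 UnI2 ex_in_conv finite.emptyI singletonI)
    then have "v \<in> f X" "v' \<in> f X" using a by (auto simp: dominating_def)
    then obtain Q where Q: "Q \<noteq> []" "last Q = v'" "set Q \<subseteq> f X" "successively ?E (v # Q)"
      using comp_path[OF directionD(1)[OF f a(3)]] v'(3) by metis
    have sQ: "set Q \<subseteq> verts G - X" using Q directionD(2)[OF f a(3)] by blast
    let ?b = "(v', X \<union> {v} \<union> (set Q - {v'}))"
    have "P ?b" using a v' sQ by (auto simp: P_def fin_sets_def dominating_def)
    moreover have "R a ?b" using Q sQ a(1) by (auto simp: R_def)
    ultimately show ?thesis by blast
  qed
  obtain v0 where "v0 \<in> ?U" using inf by (metis ex_in_conv finite.emptyI)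
  then have "P (v0, {})" by (auto simp: P_def fin_sets_def)
  then obtain s where s: "\<And>n. P (s n)" "\<And>n. R (s n) (s (Suc n))"
    using dependent_nat_choice[of "\<lambda>_. P" "\<lambda>_. R"] step by metis
  define v X where "v n = fst (s n)" and "X n = snd (s n)" for n
  have P: "v n \<in> ?U" "X n \<in> fin_sets G" "v n \<notin> X n" for n
    using s(1)[of n] by (auto simp: P_def v_def X_def split: prod.splits)
  have "\<exists>Q. Q \<noteq> [] \<and> last Q = v (Suc n) \<and> successively ?E (v n # Q) \<and>
      set Q \<subseteq> verts G - X n \<and> X (Suc n) = X n \<union> {v n} \<union> (set Q - {v (Suc n)})" for n
    using s(2)[of n] by (auto simp: R_def v_def X_def split: prod.splits)
  then obtain Q where Q: "\<And>n. Q n \<noteq> []" "\<And>n. last (Q n) = v (Suc n)"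
      "\<And>n. successively ?E (v n # Q n)" "\<And>n. set (Q n) \<subseteq> verts G - X n"
      "\<And>n. X (Suc n) = X n \<union> {v n} \<union> (set (Q n) - {v (Suc n)})"
    by metis
  have mono: "X m \<subseteq> X n" if "m \<le> n" for m n
    using that by (rule lift_Suc_mono_le[rotated]) (use Q(5) in blast)
  \<comment> \<open>The shift is by two because the endpoint \<open>v (Suc n)\<close> is added only
    one step later.\<close>
  have sub: "set (Q n) \<subseteq> X (Suc (Suc n))" for n
    using Q(5)[of n] Q(5)[of "Suc n"] by blast
  have fin: "\<exists>N. \<forall>n\<ge>N. x \<notin> set (Q n)" for x
  proof (cases "\<exists>m. x \<in> set (Q m)")
    case True
    then obtain m where "x \<in> X (Suc (Suc m))" using sub by blast
    then show ?thesis using mono Q(4) by blast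
  qed auto
  have "\<exists>N. \<forall>n\<ge>N. set (Q n) \<subseteq> f Z" if Z: "Z \<in> fin_sets G" for Z
  proof -
    obtain M where M: "\<And>x n. n \<ge> M x \<Longrightarrow> x \<notin> set (Q n)" using fin by metis
    have "finite Z" using Z by (simp add: fin_sets_def)
    define N where "N = Max (insert 0 (M ` Z))"
    have N: "set (Q n) \<inter> Z = {}" if "n \<ge> N" for n
    proof -
      have "M x \<le> n" if "x \<in> Z" for x
      proof -
        have "M x \<le> N" unfolding N_def using \<open>finite Z\<close> that by auto
        then show ?thesis using \<open>n \<ge> N\<close> by simp
      qed
      then show ?thesis using M by blast
    qed
    \<comment> \<open>One more than \<open>N\<close>: the start \<open>v n\<close> is the last
      vertex of the preceding path, which must avoid \<open>Z\<close> as well.\<close>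
    have "set (Q n) \<subseteq> f Z" if n: "n \<ge> Suc N" for n
    proof -
      obtain k where k: "n = Suc k" "k \<ge> N" using n by (metis Suc_le_D Suc_le_mono)
      have "v n \<in> set (Q k)" using Q(1,2)[of k] k by (metis last_in_set)
      then have vZ: "v n \<notin> Z" using N[of k] k by blast
      then have vf: "v n \<in> f Z" using P(1)[of n] Z by (auto simp: dominating_def)
      have "v n \<in> verts G" using P(1)[of n] by (simp add: dominating_def)
      then have *: "set (v n # Q n) \<subseteq> verts G - Z" using Q(4)[of n] N[of n] n vZ by auto
      have "successively (\<lambda>u v. (u, v) \<in> adj_minus G Z) (v n # Q n)"
        by (rule successively_mono[OF Q(3)]) (use * in \<open>auto simp: adj_minus_def\<close>)
      then show ?thesis by (rule successively_adj_comp[OF directionD(1)[OF f Z] vf])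
    qed
    then show ?thesis by blast
  qed
  moreover have "set (Q n) \<subseteq> verts G" "v 0 \<in> verts G" for n
    using Q(4)[of n] P(1)[of 0] by (auto simp: dominating_def)
  ultimately show ?thesis by (intro ray_of_direction_paths[OF f, of Q v] Q)
qed

text \<open>The sets \<open>X n\<close> are built so that the \<open>f (X n)\<close> have empty
  intersection. Then some \<open>f (X n)\<close> misses a given finite \<open>Z\<close>; being
  connected and meeting \<open>f Z\<close>, it lies in \<open>f Z\<close>.\<close>

lemma direction_ray_finite_dominating:
  assumes f: "direction G f" and fin: "finite (dominating G f)"
  shows "\<exists>r. ray G r \<and> (\<forall>X\<in>fin_sets G. has_tail_in r (f X))"
proof -
  let ?U = "dominating G f"
  have U: "?U \<in> fin_sets G" using fin by (auto simp: fin_sets_def dominating_def)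
  \<comment> \<open>A non-dominating \<open>v\<close> in \<open>X\<close> has a witness
    \<open>Z v\<close> with \<open>v\<close> outside both \<open>Z v\<close> and
    \<open>f (Z v)\<close>. Once \<open>Z v\<close> is added, \<open>v\<close> cannot be adjacent to
    the new component: it would lie in \<open>nbhd G (f (Z v))\<close>, hence in
    \<open>Z v\<close>.\<close>
  have "\<exists>X'\<in>fin_sets G. X \<subseteq> X' \<and> nbhd G (f X') \<inter> X \<subseteq> ?U" if X: "X \<in> fin_sets G" for X
  proof -
    have "\<exists>Z\<in>fin_sets G. v \<notin> Z \<and> v \<notin> f Z" if "v \<in> X - ?U" for v
      using that X by (auto simp: dominating_def fin_sets_def)
    then obtain Z where Z: "\<And>v. v \<in> X - ?U \<Longrightarrow> Z v \<in> fin_sets G \<and> v \<notin> Z v \<and> v \<notin> f (Z v)"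
      by metis
    let ?X = "X \<union> (\<Union>v\<in>X - ?U. Z v)"
    have X': "?X \<in> fin_sets G" using X Z by (auto simp: fin_sets_def)
    have "v \<in> ?U" if v: "v \<in> nbhd G (f ?X)" "v \<in> X" for v
    proof (rule ccontr)
      assume "v \<notin> ?U"
      then have vX: "v \<in> X - ?U" using v by blast
      then have "f ?X \<subseteq> f (Z v)" using Z X' by (intro direction_mono[OF f]) auto
      moreover have "nbhd G (f (Z v)) \<subseteq> Z v" using Z[OF vX] directionD[OF f] nbhd_comp_subset by metis
      ultimately show False using v Z[OF vX] by (auto simp: nbhd_def)
    qed
    then show ?thesis using X' by blast
  qed
  then obtain g where g: "\<And>X. X \<in> fin_sets G \<Longrightarrow> g X \<in> fin_sets G"
      "\<And>X. X \<in> fin_sets G \<Longrightarrow> X \<subseteq> g X"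
      "\<And>X. X \<in> fin_sets G \<Longrightarrow> nbhd G (f (g X)) \<inter> X \<subseteq> ?U"
    by metis
  obtain c where c: "\<And>X. X \<in> fin_sets G \<Longrightarrow> c X \<in> f X" using directionD(3)[OF f] by metis
  \<comment> \<open>Putting \<open>c (X n)\<close> into \<open>X (Suc n)\<close> expels it from
    \<open>f (X (Suc n))\<close>. This starts the induction for \<open>leave\<close> and makes
    consecutive path endpoints distinct.\<close>
  define X where "X = rec_nat ?U (\<lambda>_ Z. g (insert (c Z) Z))"
  have X0: "X 0 = ?U" and XS: "\<And>n. X (Suc n) = g (insert (c (X n)) (X n))"
    by (simp_all add: X_def)
  have ins: "insert (c Z) Z \<in> fin_sets G" if "Z \<in> fin_sets G" for Z
    using that c[OF that] directionD(2)[OF f that] by (auto simp: fin_sets_def)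
  have X: "X n \<in> fin_sets G" for n
    by (induction n) (simp_all add: X0 XS U g ins)
  have XSub: "insert (c (X n)) (X n) \<subseteq> X (Suc n)" for n
    unfolding XS by (intro g ins X)
  have mono: "X m \<subseteq> X n" if "m \<le> n" for m n
    using that by (rule lift_Suc_mono_le[rotated]) (use XSub in blast)
  have anti: "f (X n) \<subseteq> f (X m)" if "m \<le> n" for m n
    by (intro direction_mono[OF f] X mono that)
  have nb: "nbhd G (f (X n)) \<subseteq> X n" for n
    using directionD(1)[OF f X] nbhd_comp_subset by blast
  have nbS: "nbhd G (f (X (Suc n))) \<inter> X n \<subseteq> ?U" for n
    using g(3)[OF ins[OF X[of n]]] unfolding XS[symmetric] by blast
  \<comment> \<open>Induction along a walk in \<open>G - U\<close> from \<open>c (X 0)\<close> to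
    \<open>x\<close>, where \<open>U\<close> is the dominating set. If \<open>y\<close> is outside
    from stage \<open>k\<close> on but its neighbour \<open>z\<close> never leaves, then
    \<open>y\<close> is in the neighbourhoods of both \<open>f (X k)\<close> and
    \<open>f (X (Suc k))\<close>, which \<open>nbS\<close> allows only for dominating
    vertices.\<close>
  have leave: "\<exists>n. x \<notin> f (X n)" for x
  proof (rule ccontr)
    assume "\<nexists>n. x \<notin> f (X n)"
    then have "x \<in> f (X 0)" and all: "\<And>n. x \<in> f (X n)" by auto
    have "(c (X 0), x) \<in> (adj_minus G (X 0))\<^sup>*"
      using comp_rtrancl[OF directionD(1)[OF f X]] c[OF X] all by blast
    then have "\<exists>n. x \<notin> f (X n)"
    proof (induction rule: rtrancl_induct)
      case base
      then show ?case using XSub[of 0] directionD(2)[OF f X[of "Suc 0"]] by blast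
    next
      case (step y z)
      then obtain k where k: "y \<notin> f (X k)" by blast
      show ?case
      proof (rule ccontr)
        assume "\<nexists>n. z \<notin> f (X n)"
        moreover have "y \<in> verts G" "y \<notin> ?U" "{z, y} \<in> edges G"
          using step(2) by (auto simp: adj_minus_def X0 insert_commute)
        moreover have "y \<notin> f (X (Suc k))" using k anti[of k "Suc k"] by auto
        ultimately have "y \<in> nbhd G (f (X k))" "y \<in> nbhd G (f (X (Suc k)))"
          using k by (auto simp: nbhd_def)
        then show False using nb[of k] nbS[of k] \<open>y \<notin> ?U\<close> by blast
      qed
    qed
    then show False using all by blast
  qed
  define v where "v n = c (X n)" for n
  have v: "v n \<in> f (X n)" for n unfolding v_def by (rule c[OF X])
  have "\<exists>Q. Q \<noteq> [] \<and> last Q = v (Suc n) \<and> set Q \<subseteq> f (X n) \<and>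
           successively (\<lambda>u v. {u, v} \<in> edges G) (v n # Q)" for n
  proof (rule comp_path[OF directionD(1)[OF f X] v])
    show "v (Suc n) \<in> f (X n)" using v anti[of n "Suc n"] by auto
    show "v n \<noteq> v (Suc n)"
      using XSub[of n] v[of "Suc n"] directionD(2)[OF f X[of "Suc n"]] by (auto simp: v_def)
  qed
  then obtain Q where Q: "\<And>n. Q n \<noteq> []" "\<And>n. last (Q n) = v (Suc n)"
      "\<And>n. set (Q n) \<subseteq> f (X n)" "\<And>n. successively (\<lambda>u v. {u, v} \<in> edges G) (v n # Q n)"
    by metis
  have ev: "\<exists>N. \<forall>n\<ge>N. set (Q n) \<subseteq> f Z" if Z: "Z \<in> fin_sets G" for Z
  proof -
    obtain M where M: "\<And>x. x \<notin> f (X (M x))" using leave by metis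
    have "finite Z" using Z by (simp add: fin_sets_def)
    define N where "N = Max (insert 0 (M ` Z))"
    have "x \<notin> f (X N)" if "x \<in> Z" for x
    proof -
      have "M x \<le> N" unfolding N_def using \<open>finite Z\<close> that by auto
      then show ?thesis using M anti by blast
    qed
    then have disj: "f (X N) \<inter> Z = {}" by blast
    obtain u where "u \<in> f (X N \<union> Z)" using directionD(3)[OF f fin_sets_Un[OF X Z]] by blast
    then have "u \<in> f (X N)" "u \<in> f Z"
      using direction_mono[OF f _ fin_sets_Un[OF X Z]] X Z by blast+
    then have "f (X N) \<subseteq> f Z"
      using comp_subset_comp[OF directionD(1)[OF f X] directionD(1)[OF f Z] disj] by blast
    then show ?thesis using Q(3) anti by blast
  qed
  have "set (Q n) \<subseteq> verts G" "v 0 \<in> verts G" for n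
    using Q(3)[of n] v[of 0] directionD(2)[OF f X] by blast+
  then show ?thesis by (intro ray_of_direction_paths[OF f, of Q v] Q ev)
qed

theorem direction_ray:
  assumes "direction G f"
  shows "\<exists>r. ray G r \<and> (\<forall>X\<in>fin_sets G. has_tail_in r (f X))"
  using direction_ray_infinite_dominating[OF assms] direction_ray_finite_dominating[OF assms]
  by blast

section \<open>Ends correspond to directions\<close>

lemma has_tail_in_unique:
  assumes "C \<in> comps G X" "D \<in> comps G X" "has_tail_in r C" "has_tail_in r D"
  shows "C = D"
proof -
  obtain m n where "r ` {m..} \<subseteq> C" "r ` {n..} \<subseteq> D" using assms by (auto simp: has_tail_in_def)
  then have "r (max m n) \<in> C" "r (max m n) \<in> D" by auto
  then show ?thesis using assms comps_eqI by metis
qed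

text \<open>By injectivity a ray leaves each finite \<open>X\<close> for good, and the remaining
  tail is connected. Nestedness follows from the uniqueness of the component holding a tail.\<close>

lemma ray_direction:
  assumes r: "ray G r"
  shows "\<exists>f. direction G f \<and> (\<forall>X\<in>fin_sets G. has_tail_in r (f X))"
proof -
  have "\<exists>C\<in>comps G X. has_tail_in r C" if X: "X \<in> fin_sets G" for X
  proof -
    have "finite (r -` X)" using X r by (auto simp: fin_sets_def ray_def intro: finite_vimageI)
    then obtain N where N: "\<And>n. n \<ge> N \<Longrightarrow> r n \<notin> X"
      by (metis finite_nat_set_iff_bounded not_le vimageI)
    have V: "r n \<in> verts G" for n using r by (auto simp: ray_def)
    have "r (N + d) \<in> comp_of G X (r N)" for d
    proof (induction d)
      case (Suc d)
      have "(r (N + d), r (N + Suc d)) \<in> adj_minus G X"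
        using r N V by (auto simp: adj_minus_def ray_def)
      then show ?case using Suc by (auto simp: comp_of_def intro: rtrancl_into_rtrancl)
    qed (simp add: comp_of_self)
    then have "r ` {N..} \<subseteq> comp_of G X (r N)" by (auto simp: le_iff_add)
    then show ?thesis using comp_of_in_comps[OF V N] by (auto simp: has_tail_in_def)
  qed
  then obtain f where f: "\<And>X. X \<in> fin_sets G \<Longrightarrow> f X \<in> comps G X \<and> has_tail_in r (f X)" by metis
  have "f X' \<subseteq> f X" if X: "X \<in> fin_sets G" "X' \<in> fin_sets G" "X \<subseteq> X'" for X X'
  proof -
    obtain D where D: "D \<in> comps G X" "f X' \<subseteq> D"
      using comps_super_ex[of "f X'" G X' X] f[OF X(2)] X(3) by blast
    then have "has_tail_in r D" using f[OF X(2)] by (auto simp: has_tail_in_def)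
    then show ?thesis using D f[OF X(1)] has_tail_in_unique[of "f X" G X D r] by simp
  qed
  then have "direction G f" using f by (simp add: direction_def)
  then show ?thesis using f by blast
qed

text \<open>All rays of the class share the component of \<open>r\<close>, and \<open>r\<close>
  itself belongs to the class, so the \<open>THE\<close> in \<open>end_comp\<close> evaluates to
  \<open>f X\<close>.\<close>

lemma end_pt_eq:
  assumes f: "direction G f" and r: "ray G r" "\<forall>X\<in>fin_sets G. has_tail_in r (f X)"
  shows "end_pt G (ray_equiv G `` {r}) = (\<lambda>X\<in>fin_sets G. principal_uf G X (f X))"
  unfolding end_pt_def
proof (rule restrict_ext)
  fix X assume X: "X \<in> fin_sets G"
  have refl: "r \<in> ray_equiv G `` {r}" using r directionD(1)[OF f] by (auto simp: ray_equiv_def)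
  have "has_tail_in s (f X)" if s: "s \<in> ray_equiv G `` {r}" for s
  proof -
    obtain C where "C \<in> comps G X" "has_tail_in r C" "has_tail_in s C"
      using s X by (auto simp: ray_equiv_def)
    then show ?thesis using has_tail_in_unique directionD(1)[OF f X] r(2) X by metis
  qed
  moreover have "C = f X" if "C \<in> comps G X \<and> (\<forall>s\<in>ray_equiv G `` {r}. has_tail_in s C)" for C
    using that refl has_tail_in_unique[of C G X "f X" r] directionD(1)[OF f X] r(2) X by blast
  ultimately have "end_comp G X (ray_equiv G `` {r}) = f X" unfolding end_comp_def
    using directionD(1)[OF f X] by (intro the_equality) blast+
  then show "principal_uf G X (end_comp G X (ray_equiv G `` {r})) = principal_uf G X (f X)" by simp
qed

text \<open>With \<open>direction_ray\<close> as the hard direction, this lets limit points be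
  recognised as ends without mentioning rays.\<close>

lemma Omega_eq_directions:
  "Omega G = {\<lambda>X\<in>fin_sets G. principal_uf G X (f X) | f. direction G f}"
proof (intro subset_antisym subsetI)
  fix \<xi> assume "\<xi> \<in> Omega G"
  then obtain r where r: "ray G r" "\<xi> = end_pt G (ray_equiv G `` {r})"
    by (auto simp: Omega_def graph_ends_def quotient_def)
  obtain f where f: "direction G f" "\<forall>X\<in>fin_sets G. has_tail_in r (f X)"
    using ray_direction[OF r(1)] by blast
  show "\<xi> \<in> {\<lambda>X\<in>fin_sets G. principal_uf G X (f X) | f. direction G f}"
    unfolding r(2) end_pt_eq[OF f(1) r(1) f(2)] using f(1) by blast
next
  fix \<xi> assume "\<xi> \<in> {\<lambda>X\<in>fin_sets G. principal_uf G X (f X) | f. direction G f}"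
  then obtain f where f: "direction G f" "\<xi> = (\<lambda>X\<in>fin_sets G. principal_uf G X (f X))" by blast
  then obtain r where r: "ray G r" "\<forall>X\<in>fin_sets G. has_tail_in r (f X)" using direction_ray by blast
  have "\<xi> = end_pt G (ray_equiv G `` {r})" using end_pt_eq[OF f(1) r] f(2) by simp
  then show "\<xi> \<in> Omega G" unfolding Omega_def graph_ends_def
    using r(1) by (auto intro: quotientI)
qed


section \<open>Filters on the components\<close>

lemma principal_uf_inject:
  assumes "C \<in> comps G X"
  shows "principal_uf G X C = principal_uf G X D \<longleftrightarrow> C = D"
proof
  assume "principal_uf G X C = principal_uf G X D"
  moreover have "{C} \<in> principal_uf G X C" using assms by (simp add: principal_uf_def)
  ultimately show "C = D" by (auto simp: principal_uf_def)
qed simp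

text \<open>The largest possible witness in the definition is
  \<open>comps_at G X Y \<inter> \<A>\<close>.\<close>

lemma crit_filter_iff:
  "\<A> \<in> crit_filter G X Y \<longleftrightarrow> \<A> \<subseteq> comps G X \<and> finite (comps_at G X Y - \<A>)"
proof
  assume "\<A> \<in> crit_filter G X Y"
  then obtain \<B> where "\<A> \<subseteq> comps G X" "finite (comps_at G X Y - \<B>)" "\<B> \<subseteq> \<A>"
    by (auto simp: crit_filter_def)
  moreover from this have "comps_at G X Y - \<A> \<subseteq> comps_at G X Y - \<B>" by blast
  ultimately show "\<A> \<subseteq> comps G X \<and> finite (comps_at G X Y - \<A>)"
    using finite_subset by blast
next
  assume "\<A> \<subseteq> comps G X \<and> finite (comps_at G X Y - \<A>)"
  moreover have "comps_at G X Y - comps_at G X Y \<inter> \<A> = comps_at G X Y - \<A>" by blast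
  ultimately show "\<A> \<in> crit_filter G X Y"
    by (auto simp: crit_filter_def intro!: exI[of _ "comps_at G X Y \<inter> \<A>"])
qed

text \<open>Removing the single component \<open>C\<close> from \<open>comps G X\<close> leaves a
  member of the first filter but not of the second.\<close>

lemma crit_filter_not_principal: "crit_filter G X Y \<noteq> principal_uf G X C"
proof
  assume eq: "crit_filter G X Y = principal_uf G X C"
  have "comps_at G X Y - (comps G X - {C}) \<subseteq> {C}" by (auto simp: comps_at_def)
  then have "comps G X - {C} \<in> crit_filter G X Y"
    unfolding crit_filter_iff using finite_subset by blast
  then show False unfolding eq by (simp add: principal_uf_def)
qed

text \<open>For distinct \<open>Y\<close> and \<open>Y'\<close> the sets \<open>comps_at\<close> are
  disjoint, so neither can contain almost all of the other when that is infinite.\<close>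

lemma crit_filter_inject:
  assumes "Y \<in> crit G X" "crit_filter G X Y = crit_filter G X Y'"
  shows "Y = Y'"
proof -
  have "comps_at G X Y' \<in> crit_filter G X Y'" by (auto simp: crit_filter_iff comps_at_def)
  then have "finite (comps_at G X Y - comps_at G X Y')"
    unfolding assms(2)[symmetric] crit_filter_iff by blast
  moreover have "infinite (comps_at G X Y)" using assms(1) by (simp add: crit_def)
  ultimately have "comps_at G X Y - comps_at G X Y' \<noteq> comps_at G X Y" by metis
  then show ?thesis by (auto simp: comps_at_def)
qed

lemma F_map_principal:
  assumes "C' \<in> comps G X'"
  shows "F_map G X' X (principal_uf G X' C') = principal_uf G X (comp_map G X' X C')"
proof -
  have "(THE C. C \<in> comps G X' \<and> principal_uf G X' C' = principal_uf G X' C) = C'"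
    using assms principal_uf_inject[OF assms] by (intro the_equality) auto
  then show ?thesis using assms by (auto simp: F_map_def)
qed

lemma F_map_crit_filter:
  assumes "Y \<in> crit G X'"
  shows "F_map G X' X (crit_filter G X' Y) =
    (if Y \<subseteq> X then crit_filter G X Y
     else principal_uf G X (THE C. C \<in> comps G X \<and> \<Union>(comps_at G X' Y) \<subseteq> C))"
proof -
  have "(THE Z. Z \<in> crit G X' \<and> crit_filter G X' Y = crit_filter G X' Z) = Y"
    using assms crit_filter_inject[OF assms] by (intro the_equality) auto
  then show ?thesis by (simp add: F_map_def crit_filter_not_principal)
qed

lemma U_map_principal:
  assumes "C' \<in> comps G X'"
  shows "U_map G X' X (principal_uf G X' C') = principal_uf G X (comp_map G X' X C')"
  using assms by (auto simp: U_map_def principal_uf_def intro!: bexI[of _ "{C'}"])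

section \<open>Topologies on the filter spaces, and how the two kinds of filter differ\<close>

lemma topspace_FX_top: "topspace (FX_top G X) = FX G X"
proof -
  have "comps G X \<in> F" if "F \<in> FX G X" for F
    using that by (auto simp: FX_def principal_uf_def crit_filter_iff comps_at_def Diff_eq_empty_iff[THEN iffD2])
  then show ?thesis by (auto simp: FX_top_def filter_topology_def topology_generated_by_topspace)
qed

lemma topspace_UX_top: "topspace (UX_top G X) = UX G X"
proof -
  have "comps G X \<in> F" if "F \<in> UX G X" for F
    using that by (auto simp: UX_def ultrafilter_on_def)
  then show ?thesis by (auto simp: UX_top_def filter_topology_def topology_generated_by_topspace)
qed

lemma openin_UX_basic: "\<A> \<subseteq> comps G X \<Longrightarrow> openin (UX_top G X) {U \<in> UX G X. \<A> \<in> U}"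
  unfolding UX_top_def filter_topology_def by (rule topology_generated_by_Basis) blast

text \<open>Split \<open>D\<close> into two infinite halves \<open>A\<close> and
  \<open>D - A\<close>: whichever of \<open>A\<close> and \<open>S - A\<close> is in
  \<open>U\<close> omits an infinite part of \<open>D\<close>. A member of a
  \<open>crit_filter\<close> omits only finitely many elements of \<open>comps_at\<close>.\<close>

lemma ultrafilter_misses_infinite:
  assumes U: "ultrafilter_on S U" and D: "D \<subseteq> S" "infinite D"
  shows "\<exists>\<A>\<in>U. \<A> \<subseteq> S \<and> infinite (D - \<A>)"
proof -
  obtain A B where AB: "A \<subseteq> D" "B \<subseteq> D" "infinite A" "infinite B" "A \<inter> B = {}"
    using infinite_split[OF D(2)] by metis
  then have "B \<subseteq> D - A" by blast
  then have A: "A \<subseteq> D" "infinite A" "infinite (D - A)" using AB finite_subset by blast+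
  have "D - (S - A) = A" using A D by blast
  moreover have "A \<in> U \<or> S - A \<in> U" using U A D by (auto simp: ultrafilter_on_def)
  ultimately show ?thesis using A D by (metis Diff_subset subset_trans)
qed

text \<open>The principal filters at the components in \<open>comps_at G X Y\<close> converge to
  \<open>crit_filter G X Y\<close>. For a basic set given by \<open>\<A>\<close> the exceptions lie
  in \<open>comps_at G X Y - \<A>\<close>, and the property passes to finite intersections and to
  unions.\<close>

lemma open_at_crit_filter:
  assumes "openin (FX_top G X) Q" "crit_filter G X Y \<in> Q"
  shows "finite {C \<in> comps_at G X Y. principal_uf G X C \<notin> Q}"
proof -
  have "generate_topology_on {{F \<in> FX G X. \<A> \<in> F} | \<A>. \<A> \<subseteq> comps G X} Q"
    using assms(1) by (simp add: FX_top_def filter_topology_def openin_topology_generated_by_iff)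
  then show ?thesis using assms(2)
  proof (induction rule: generate_topology_on.induct)
    case (Int a b)
    have "{C \<in> comps_at G X Y. principal_uf G X C \<notin> a \<inter> b} =
        {C \<in> comps_at G X Y. principal_uf G X C \<notin> a} \<union>
        {C \<in> comps_at G X Y. principal_uf G X C \<notin> b}" by blast
    then show ?case using Int by simp
  next
    case (UN K)
    then obtain k where k: "k \<in> K" "crit_filter G X Y \<in> k" by blast
    then have "finite {C \<in> comps_at G X Y. principal_uf G X C \<notin> k}" using UN by blast
    then show ?case by (rule rev_finite_subset) (use k in blast)
  next
    case (Basis s)
    then obtain \<A> where \<A>: "s = {F \<in> FX G X. \<A> \<in> F}" "\<A> \<subseteq> comps G X" by blast
    then have "finite (comps_at G X Y - \<A>)" using Basis(2) by (simp add: crit_filter_iff)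
    then show ?case
      by (rule rev_finite_subset)
        (use \<A> in \<open>auto simp: FX_def principal_uf_def comps_at_def\<close>)
  qed simp
qed


section \<open>The point of \<open>\<FF>\<close> given by a critical vertex set\<close>

text \<open>By \<open>critical_comp_unique\<close> all of \<open>Y - X\<close> lies in one component
  of \<open>G - X\<close> when \<open>Y\<close> is critical, so the choice made by
  \<open>SOME\<close> is immaterial.\<close>

definition crit_pt :: "'a graph \<Rightarrow> 'a set \<Rightarrow> 'a limit_pt" where
  "crit_pt G Y = (\<lambda>X\<in>fin_sets G. if Y \<subseteq> X then crit_filter G X Y
                    else principal_uf G X (comp_of G X (SOME y. y \<in> Y - X)))"

lemma critical_of_infinite_comps:
  assumes X: "X \<in> fin_sets G" and inf: "infinite (comps G X)"
  shows "\<exists>Y\<in>fin_sets G. infinite (comps_at G Y Y)"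
proof -
  have "comps G X = (\<Union>Y\<in>Pow X. comps_at G X Y)"
    using nbhd_comp_subset by (fastforce simp: comps_at_def)
  moreover have "finite (Pow X)" using X by (simp add: fin_sets_def)
  ultimately obtain Y where Y: "Y \<subseteq> X" "infinite (comps_at G X Y)"
    using inf by (metis PowD finite_UN_I)
  \<comment> \<open>Passing from \<open>X\<close> to \<open>Y\<close> itself leaves a single set to
    work with.\<close>
  have "comps_at G X Y \<subseteq> comps_at G Y Y"
    using Y comps_at_comp comp_subset by (blast intro: comps_at_transfer)
  then show ?thesis using Y X by (auto simp: fin_sets_def dest: finite_subset)
qed

section \<open>Components attached to a fixed critical set\<close>

context
  fixes G :: "'a graph" and Y :: "'a set"
  assumes Y: "Y \<in> fin_sets G" and inf: "infinite (comps_at G Y Y)"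
begin

lemma finite_critical_meeting: "X \<in> fin_sets G \<Longrightarrow> finite {C \<in> comps_at G Y Y. C \<inter> X \<noteq> {}}"
  by (rule finite_subset[OF _ finite_comps_meeting[of X G Y]]) (auto simp: comps_at_def fin_sets_def)

lemma critical_avoiding:
  assumes "X \<in> fin_sets G" shows "\<exists>C\<in>comps_at G Y Y. C \<inter> X = {}"
proof (rule ccontr)
  assume "\<not> ?thesis"
  then have "comps_at G Y Y = {C \<in> comps_at G Y Y. C \<inter> X \<noteq> {}}" by blast
  then show False using finite_critical_meeting[OF assms] inf by simp
qed

text \<open>All but finitely many of the components avoid \<open>X\<close>, and those remain
  components of \<open>G - X\<close> with neighbourhood \<open>Y\<close>.\<close>

lemma critical_in_crit:
  assumes "X \<in> fin_sets G" "Y \<subseteq> X" shows "Y \<in> crit G X"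
proof -
  have "comps_at G Y Y \<subseteq> comps_at G X Y \<union> {C \<in> comps_at G Y Y. C \<inter> X \<noteq> {}}"
    using comps_at_transfer[OF _ _ assms(2)] by blast
  then have "infinite (comps_at G X Y)"
    using inf finite_critical_meeting[OF assms(1)] by (meson finite_UnI finite_subset)
  then show ?thesis using assms by (simp add: crit_def)
qed

text \<open>\<open>y\<close> sends an edge to \<open>C\<close>, so \<open>C\<close> together with
  \<open>y\<close> is connected in \<open>G - X\<close>.\<close>

lemma critical_comp_subset:
  assumes y: "y \<in> Y" "y \<notin> X" and C: "C \<in> comps_at G Z Y" "C \<inter> X = {}"
  shows "C \<subseteq> comp_of G X y"
proof -
  have "y \<in> nbhd G C" using y C by (simp add: comps_at_def)
  then obtain u where u: "u \<in> C" "{u, y} \<in> edges G" "y \<in> verts G" by (auto simp: nbhd_def)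
  then have "(y, u) \<in> adj_minus G X"
    using y C(2) comp_subset[OF comps_at_comp[OF C(1)]] by (auto simp: adj_minus_def insert_commute)
  then have "u \<in> comp_of G X y" by (auto simp: comp_of_def)
  then show ?thesis
    using comp_subset_comp[OF comps_at_comp[OF C(1)] comp_of_in_comps[OF u(3) y(2)] C(2) u(1)] by simp
qed

text \<open>A component in \<open>comps_at G Y Y\<close> that avoids \<open>X\<close> is attached to
  both vertices and joins them.\<close>

lemma critical_comp_unique:
  assumes "X \<in> fin_sets G" "y \<in> Y - X" "y' \<in> Y - X"
  shows "comp_of G X y = comp_of G X y'"
proof -
  obtain C where C: "C \<in> comps_at G Y Y" "C \<inter> X = {}" using critical_avoiding[OF assms(1)] by blast
  obtain u where "u \<in> C" using comp_nonempty[OF comps_at_comp[OF C(1)]] by blast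
  then have "u \<in> comp_of G X y" "u \<in> comp_of G X y'"
    using critical_comp_subset[OF _ _ C] assms by blast+
  then show ?thesis by (metis comp_of_eq)
qed

lemma crit_pt_superset: "X \<in> fin_sets G \<Longrightarrow> Y \<subseteq> X \<Longrightarrow> crit_pt G Y X = crit_filter G X Y"
  by (simp add: crit_pt_def)

lemma crit_pt_not_superset:
  assumes "X \<in> fin_sets G" "y \<in> Y - X"
  shows "crit_pt G Y X = principal_uf G X (comp_of G X y)"
proof -
  have "(SOME y. y \<in> Y - X) \<in> Y - X" using assms(2) by (rule someI)
  then have "comp_of G X (SOME y. y \<in> Y - X) = comp_of G X y"
    using critical_comp_unique[OF assms(1)] assms(2) by blast
  moreover have "\<not> Y \<subseteq> X" using assms(2) by blast
  ultimately show ?thesis unfolding crit_pt_def using assms(1) by simp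
qed

lemma critical_subset_verts: "Y \<subseteq> verts G"
  using Y by (simp add: fin_sets_def)

lemma crit_pt_in_F_limit: "crit_pt G Y \<in> F_limit G"
proof -
  have "crit_pt G Y X \<in> FX G X" if X: "X \<in> fin_sets G" for X
  proof (cases "Y \<subseteq> X")
    case True
    then show ?thesis using crit_pt_superset critical_in_crit X by (simp add: FX_def)
  next
    case False
    then obtain y where "y \<in> Y - X" by blast
    then show ?thesis using crit_pt_not_superset[OF X] critical_subset_verts
      by (auto simp: FX_def intro!: imageI comp_of_in_comps)
  qed
  moreover have "F_map G X' X (crit_pt G Y X') = crit_pt G Y X"
    if X: "X \<in> fin_sets G" and X': "X' \<in> fin_sets G" and sub: "X \<subseteq> X'" for X X'
  proof (cases "Y \<subseteq> X'")
    case True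
    then have crit: "Y \<in> crit G X'" by (rule critical_in_crit[OF X'])
    show ?thesis
    proof (cases "Y \<subseteq> X")
      case True
      then show ?thesis using X X' sub crit \<open>Y \<subseteq> X'\<close> by (simp add: crit_pt_superset F_map_crit_filter)
    next
      case False
      \<comment> \<open>All components in \<open>comps_at G X' Y\<close> are attached to
        \<open>y\<close>, so the \<open>THE\<close> in \<open>F_map\<close> is the component of
        \<open>y\<close>; a vertex \<open>u\<close> of their union makes it unique.\<close>
      then obtain y where y: "y \<in> Y" "y \<notin> X" by blast
      have sub': "\<Union>(comps_at G X' Y) \<subseteq> comp_of G X y"
        using critical_comp_subset[OF y] comp_subset[OF comps_at_comp] sub by blast
      have y_in: "comp_of G X y \<in> comps G X" using y critical_subset_verts by (blast intro: comp_of_in_comps)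
      have "comps_at G X' Y \<noteq> {}" using crit by (auto simp: crit_def)
      then obtain u where u: "u \<in> \<Union>(comps_at G X' Y)" using comps_at_comp comp_nonempty by blast
      have "(THE C. C \<in> comps G X \<and> \<Union>(comps_at G X' Y) \<subseteq> C) = comp_of G X y"
      proof (rule the_equality)
        fix D assume "D \<in> comps G X \<and> \<Union>(comps_at G X' Y) \<subseteq> D"
        then show "D = comp_of G X y" using u sub' y_in comps_eqI[of D G X "comp_of G X y" u] by blast
      qed (use sub' y_in in blast)
      then show ?thesis
        using False \<open>Y \<subseteq> X'\<close> y X X' crit by (simp add: crit_pt_superset F_map_crit_filter crit_pt_not_superset)
    qed
  next
    case False
    \<comment> \<open>Now both coordinates are principal, and one \<open>y\<close> outside
      \<open>X'\<close> represents them both.\<close>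
    then obtain y where y: "y \<in> Y - X'" by blast
    then have y': "y \<in> Y - X" using sub by blast
    have c: "comp_of G X' y \<in> comps G X'" "comp_of G X y \<in> comps G X"
      using y y' critical_subset_verts by (blast intro: comp_of_in_comps)+
    then show ?thesis
      using comp_map_eq[OF c(1) sub c(2) comp_of_self comp_of_self]
      by (simp add: crit_pt_not_superset[OF X y'] crit_pt_not_superset[OF X' y] F_map_principal)
  qed
  moreover have "crit_pt G Y \<in> extensional (fin_sets G)" by (simp add: crit_pt_def)
  ultimately show ?thesis by (auto simp: F_limit_def inv_limit_def PiE_iff)
qed

lemma crit_pt_not_in_Omega: "crit_pt G Y \<notin> Omega G"
proof
  assume "crit_pt G Y \<in> Omega G"
  then obtain \<omega> where "crit_pt G Y = end_pt G \<omega>" by (auto simp: Omega_def)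
  then have "crit_pt G Y Y = principal_uf G Y (end_comp G Y \<omega>)" using Y by (simp add: end_pt_def)
  then show False unfolding crit_pt_superset[OF Y order_refl] using crit_filter_not_principal by blast
qed

text \<open>The image of \<open>crit_filter G Y Y\<close> is an ultrafilter with a member
  \<open>\<A>\<close> omitting infinitely many components at \<open>Y\<close>. By continuity almost
  all of their principal filters map into the open set of \<open>\<A>\<close>, yet they are mapped
  to themselves.\<close>

lemma not_U_system_le_F_system: "\<not> sys_le G (U_system G) (F_system G)"
proof
  assume "sys_le G (U_system G) (F_system G)"
  then obtain f where f: "continuous_map (FX_top G Y) (UX_top G Y) f"
      "\<And>C. C \<in> comps G Y \<Longrightarrow> f (principal_uf G Y C) = principal_uf G Y C"
    using Y by (auto simp: U_system_def F_system_def)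
  have cf: "crit_filter G Y Y \<in> FX G Y" using critical_in_crit[OF Y] by (auto simp: FX_def)
  then have "f (crit_filter G Y Y) \<in> UX G Y"
    using continuous_map_funspace[OF f(1)] by (auto simp: topspace_UX_top topspace_FX_top)
  moreover have "comps_at G Y Y \<subseteq> comps G Y" by (auto simp: comps_at_def)
  ultimately obtain \<A> where \<A>: "\<A> \<in> f (crit_filter G Y Y)" "\<A> \<subseteq> comps G Y"
      "infinite (comps_at G Y Y - \<A>)" "f (crit_filter G Y Y) \<in> UX G Y"
    using ultrafilter_misses_infinite[of "comps G Y" "f (crit_filter G Y Y)" "comps_at G Y Y"] inf
    by (auto simp: UX_def)
  let ?Q = "{F \<in> topspace (FX_top G Y). f F \<in> {U \<in> UX G Y. \<A> \<in> U}}"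
  have "openin (FX_top G Y) ?Q"
    by (rule openin_continuous_map_preimage[OF f(1) openin_UX_basic[OF \<A>(2)]])
  moreover have "crit_filter G Y Y \<in> ?Q" using cf \<A> by (simp add: topspace_FX_top)
  ultimately have "finite {C \<in> comps_at G Y Y. principal_uf G Y C \<notin> ?Q}" by (rule open_at_crit_filter)
  moreover have "comps_at G Y Y - \<A> \<subseteq> {C \<in> comps_at G Y Y. principal_uf G Y C \<notin> ?Q}"
    using f(2) by (auto simp: comps_at_def principal_uf_def)
  ultimately show False using \<A>(3) finite_subset by blast
qed

text \<open>The counterpart of \<open>open_at_crit_filter\<close> in \<open>F_G\<close>: whole
  components at \<open>Y\<close>, seen as sets of vertices, converge to
  \<open>crit_pt G Y\<close>.\<close>

lemma open_at_crit_pt: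
  assumes "openin (F_G G) Q" "Inr (crit_pt G Y) \<in> Q"
  shows "finite {C \<in> comps_at G Y Y. \<not> (\<forall>z\<in>C. Inl (vertex_pt z) \<in> Q)}"
proof -
  have "generate_topology_on ({Inl ` Q | Q. openin (one_complex G) Q} \<union>
      {limit_nbhd G (F_limit G) X Q | X Q. X \<in> fin_sets G \<and> openin (FX_top G X) Q}) Q"
    using assms(1) by (simp add: F_G_def ext_topology_def openin_topology_generated_by_iff)
  then show ?thesis using assms(2)
  proof (induction rule: generate_topology_on.induct)
    case (Int a b)
    have "{C \<in> comps_at G Y Y. \<not> (\<forall>z\<in>C. Inl (vertex_pt z) \<in> a \<inter> b)} =
        {C \<in> comps_at G Y Y. \<not> (\<forall>z\<in>C. Inl (vertex_pt z) \<in> a)} \<union>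
        {C \<in> comps_at G Y Y. \<not> (\<forall>z\<in>C. Inl (vertex_pt z) \<in> b)}" by blast
    then show ?case using Int by simp
  next
    case (UN K)
    then obtain k where k: "k \<in> K" "Inr (crit_pt G Y) \<in> k" by blast
    then have "finite {C \<in> comps_at G Y Y. \<not> (\<forall>z\<in>C. Inl (vertex_pt z) \<in> k)}" using UN by blast
    then show ?case by (rule rev_finite_subset) (use k in blast)
  next
    case (Basis s)
    \<comment> \<open>Open sets of the 1-complex contain no limit point, so \<open>s\<close> is of
      the other kind.\<close>
    then obtain X Q where X: "X \<in> fin_sets G" and Q: "openin (FX_top G X) Q"
      and s: "s = limit_nbhd G (F_limit G) X Q" by blast
    let ?W = "\<Union>{C \<in> comps G X. principal_uf G X C \<in> Q}"
    \<comment> \<open>The exceptions: components meeting \<open>X\<close>, and components at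
      \<open>X\<close> whose principal filter lies outside \<open>Q\<close>.\<close>
    let ?B = "{C \<in> comps_at G Y Y. C \<inter> X \<noteq> {}} \<union> {C \<in> comps_at G X Y. principal_uf G X C \<notin> Q}"
    have in_s: "Inl (vertex_pt z) \<in> s" if "z \<in> ?W" for z
      using that by (auto simp: s limit_nbhd_def Let_def induced_pts_def)
    have pt: "crit_pt G Y X \<in> Q" using Basis(2) by (auto simp: s limit_nbhd_def Let_def)
    show ?case
    proof (cases "Y \<subseteq> X")
      case True
      then have "finite ?B"
        using pt X crit_pt_superset finite_critical_meeting open_at_crit_filter[OF Q] by simp
      moreover have "C \<subseteq> ?W" if "C \<in> comps_at G Y Y" "C \<notin> ?B" for C
      proof -
        have "C \<in> comps_at G X Y" using that True by (auto intro: comps_at_transfer)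
        then show ?thesis using that comps_at_comp by blast
      qed
      then have "{C \<in> comps_at G Y Y. \<not> (\<forall>z\<in>C. Inl (vertex_pt z) \<in> s)} \<subseteq> ?B"
        using in_s by blast
      ultimately show ?thesis by (rule rev_finite_subset)
    next
      case False
      \<comment> \<open>Here \<open>Q\<close> contains the principal filter at the component of
        \<open>y\<close>, which includes every critical component avoiding \<open>X\<close>.\<close>
      then obtain y where y: "y \<in> Y" "y \<notin> X" by blast
      then have "comp_of G X y \<subseteq> ?W"
        using pt crit_pt_not_superset[OF X] critical_subset_verts comp_of_in_comps by fastforce
      then have "C \<subseteq> ?W" if "C \<in> comps_at G Y Y" "C \<inter> X = {}" for C
        using critical_comp_subset[OF y that] by blast
      then have "{C \<in> comps_at G Y Y. \<not> (\<forall>z\<in>C. Inl (vertex_pt z) \<in> s)} \<subseteq>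
          {C \<in> comps_at G Y Y. C \<inter> X \<noteq> {}}" using in_s by blast
      then show ?thesis using finite_critical_meeting[OF X] finite_subset by blast
    qed
  qed simp
qed

end


section \<open>The 1-complex\<close>

lemma simple_graph_edgeD:
  assumes "simple_graph G" "{u, v} \<in> edges G" shows "u \<in> verts G" "v \<in> verts G" "u \<noteq> v"
proof -
  obtain a b where "a \<in> verts G" "b \<in> verts G" "a \<noteq> b" "{u, v} = {a, b}"
    using assms unfolding simple_graph_def by metis
  then show "u \<in> verts G" "v \<in> verts G" "u \<noteq> v" by (auto simp: doubleton_eq_iff)
qed

text \<open>No barycentric coordinate of an inner point equals 1.\<close>

lemma vertex_pt_notin_inner_pts: "vertex_pt z \<notin> inner_pts G A B"
proof
  assume "vertex_pt z \<in> inner_pts G A B"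
  then obtain u v t where eq: "vertex_pt z = edge_pt u v t" and t: "0 < t" "t < 1"
    by (auto simp: inner_pts_def)
  show False using fun_cong[OF eq, of z] t by (simp add: vertex_pt_def edge_pt_def split: if_splits)
qed

lemma vertex_pt_in_induced_pts_iff: "vertex_pt z \<in> induced_pts G W \<longleftrightarrow> z \<in> W"
proof -
  have "z = z'" if "vertex_pt z = vertex_pt z'" for z'
    using fun_cong[OF that, of z] by (simp add: vertex_pt_def split: if_splits)
  then show ?thesis
    by (auto simp: induced_pts_def vertex_pt_notin_inner_pts)
qed

lemma topspace_one_complex_subset:
  assumes "simple_graph G" shows "topspace (one_complex G) \<subseteq> complex_pts G"
proof -
  have inner: "edge_pt u v t \<in> complex_pts G" if "{u, v} \<in> edges G" "0 < t" "t < 1" for u v t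
    using that simple_graph_edgeD[OF assms that(1)]
    by (auto simp: complex_pts_def induced_pts_def inner_pts_def)
  have "edge_pt u v 0 = vertex_pt u" for u v :: 'a by (auto simp: edge_pt_def vertex_pt_def)
  then have half: "edge_pt u v t \<in> complex_pts G" if "{u, v} \<in> edges G" "0 \<le> t" "t < 1" for u v t
    using inner[of u v t] that simple_graph_edgeD[OF assms that(1)]
    by (cases "t = 0") (auto simp: complex_pts_def induced_pts_def)
  have "vertex_star G u \<epsilon> \<subseteq> complex_pts G" if "u \<in> verts G" "\<forall>v. 0 < \<epsilon> v \<and> \<epsilon> v \<le> 1" for u \<epsilon>
  proof -
    have "vertex_pt u \<in> complex_pts G" using that by (simp add: complex_pts_def induced_pts_def)
    moreover have "t < 1" if "t < \<epsilon> v" for t v using that \<open>\<forall>v. _ v\<close> by (meson less_le_trans)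
    ultimately show ?thesis using half by (auto simp: vertex_star_def)
  qed
  moreover have "edge_pt u v ` {a<..<b} \<subseteq> complex_pts G" if "{u, v} \<in> edges G" "0 \<le> a" "b \<le> 1" for u v a b
    using inner that by auto
  ultimately show ?thesis
    unfolding one_complex_def topology_generated_by_topspace by blast
qed

text \<open>It ensures that a point outside the 1-complex is a limit point, which locates the
  preimage of \<open>crit_pt\<close> below.\<close>

lemma topspace_ext_topology_subset:
  assumes "simple_graph G" shows "topspace (ext_topology G T L) \<subseteq> Inl ` complex_pts G \<union> Inr ` L"
proof -
  have mono: "inner_pts G A B \<subseteq> inner_pts G A' B'" if "A \<subseteq> A'" "B \<subseteq> B'" for A B A' B'
    using that unfolding inner_pts_def by blast
  have pts: "induced_pts G W \<union> inner_pts G X W \<subseteq> complex_pts G" if "X \<subseteq> verts G" "W \<subseteq> verts G" for X W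
    using that mono[of W "verts G" W "verts G"] mono[of X "verts G" W "verts G"]
    unfolding complex_pts_def induced_pts_def by blast
  have W: "\<Union>{C \<in> comps G X. principal_uf G X C \<in> Q} \<subseteq> verts G" for X Q
    using comp_subset by blast
  have "induced_pts G (\<Union>{C \<in> comps G X. principal_uf G X C \<in> Q}) \<union>
      inner_pts G X (\<Union>{C \<in> comps G X. principal_uf G X C \<in> Q}) \<subseteq> complex_pts G"
    if "X \<in> fin_sets G" for X Q
    by (rule pts[OF _ W]) (use that in \<open>simp add: fin_sets_def\<close>)
  then have "limit_nbhd G L X Q \<subseteq> Inl ` complex_pts G \<union> Inr ` L" if "X \<in> fin_sets G" for X Q
    unfolding limit_nbhd_def Let_def using that by (intro Un_mono image_mono) auto
  moreover have "Inl ` Q \<subseteq> Inl ` complex_pts G \<union> Inr ` L" if "openin (one_complex G) Q" for Q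
    using openin_subset[OF that] topspace_one_complex_subset[OF assms] by blast
  ultimately show ?thesis
    unfolding ext_topology_def topology_generated_by_topspace by blast
qed

lemma vertex_pt_in_topspace:
  assumes "z \<in> verts G" shows "Inl (vertex_pt z) \<in> topspace (ext_topology G T L)"
proof -
  have "openin (one_complex G) (vertex_star G z (\<lambda>_. 1))"
    unfolding one_complex_def using assms
    by (intro topology_generated_by_Basis UnI2 CollectI exI[of _ z] exI[of _ "\<lambda>_. 1"]) simp
  then have "openin (ext_topology G T L) (Inl ` vertex_star G z (\<lambda>_. 1))"
    unfolding ext_topology_def by (intro topology_generated_by_Basis) blast
  moreover have "vertex_pt z \<in> vertex_star G z (\<lambda>_. 1)" by (simp add: vertex_star_def)
  ultimately show ?thesis using openin_subset by blast
qed

lemma openin_limit_nbhd: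
  "X \<in> fin_sets G \<Longrightarrow> openin (T X) Q \<Longrightarrow> openin (ext_topology G T L) (limit_nbhd G L X Q)"
  unfolding ext_topology_def by (rule topology_generated_by_Basis) blast

lemma not_Omega_cpt_equivalent:
  assumes G: "simple_graph G" and Y: "Y \<in> fin_sets G" and inf: "infinite (comps_at G Y Y)"
  shows "\<not> Omega_cpt_equivalent G (theta_G G) (F_G G)"
proof
  assume "Omega_cpt_equivalent G (theta_G G) (F_G G)"
  then obtain h where h: "homeomorphic_map (theta_G G) (F_G G) h"
      "\<And>p. p \<in> complex_pts G \<Longrightarrow> h (Inl p) = Inl p"
    by (auto simp: Omega_cpt_equivalent_def)
  have L: "crit_pt G Y \<in> F_limit G" by (rule crit_pt_in_F_limit[OF Y inf])
  then have "crit_pt G Y Y \<in> topspace (FX_top G Y)"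
    using Y by (auto simp: F_limit_def inv_limit_def topspace_FX_top)
  then have "Inr (crit_pt G Y) \<in> limit_nbhd G (F_limit G) Y (topspace (FX_top G Y))"
    using L by (simp add: limit_nbhd_def Let_def)
  moreover have "openin (F_G G) (limit_nbhd G (F_limit G) Y (topspace (FX_top G Y)))"
    unfolding F_G_def by (rule openin_limit_nbhd[OF Y]) simp
  ultimately have "Inr (crit_pt G Y) \<in> topspace (F_G G)" using openin_subset by blast
  then obtain p where p: "p \<in> topspace (theta_G G)" "h p = Inr (crit_pt G Y)"
    using homeomorphic_imp_surjective_map[OF h(1)] by (metis imageE)
  \<comment> \<open>\<open>h\<close> fixes the points of the 1-complex, so the preimage of a limit
    point is a limit point.\<close>
  have "p \<notin> Inl ` complex_pts G" using h(2) p(2) by auto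
  then obtain \<eta> where \<eta>: "p = Inr \<eta>" "\<eta> \<in> U_limit G"
    using topspace_ext_topology_subset[OF G] p(1) unfolding theta_G_def by blast
  then have \<eta>Y: "\<eta> Y \<in> UX G Y" using Y by (auto simp: U_limit_def inv_limit_def)
  have "comps_at G Y Y \<subseteq> comps G Y" by (auto simp: comps_at_def)
  then obtain \<A> where \<A>: "\<A> \<in> \<eta> Y" "\<A> \<subseteq> comps G Y" "infinite (comps_at G Y Y - \<A>)"
    using ultrafilter_misses_infinite[of "comps G Y" "\<eta> Y" "comps_at G Y Y"] inf \<eta>Y
    by (auto simp: UX_def)
  \<comment> \<open>The vertices in this neighbourhood of \<open>\<eta>\<close> lie in components
    from \<open>\<A>\<close>, whereas its image is a neighbourhood of \<open>crit_pt G Y\<close> and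
    contains almost all components at \<open>Y\<close>.\<close>
  let ?O = "limit_nbhd G (U_limit G) Y {U \<in> UX G Y. \<A> \<in> U}"
  have O: "openin (theta_G G) ?O"
    unfolding theta_G_def by (rule openin_limit_nbhd) (use Y openin_UX_basic[OF \<A>(2)] in auto)
  then have "openin (F_G G) (h ` ?O)"
    using homeomorphic_imp_open_map[OF h(1)] by (simp add: open_map_def)
  moreover have "Inr \<eta> \<in> ?O" using \<eta> \<eta>Y \<A> by (simp add: limit_nbhd_def Let_def)
  then have "h (Inr \<eta>) \<in> h ` ?O" by (rule imageI)
  then have "Inr (crit_pt G Y) \<in> h ` ?O" using p(2) unfolding \<eta>(1) by (simp only:)
  ultimately have "finite {C \<in> comps_at G Y Y. \<not> (\<forall>z\<in>C. Inl (vertex_pt z) \<in> h ` ?O)}"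
    by (rule open_at_crit_pt[OF Y inf])
  moreover have "comps_at G Y Y - \<A> \<subseteq> {C \<in> comps_at G Y Y. \<not> (\<forall>z\<in>C. Inl (vertex_pt z) \<in> h ` ?O)}"
  proof
    fix C assume C: "C \<in> comps_at G Y Y - \<A>"
    then have C': "C \<in> comps G Y" by (simp add: comps_at_def)
    then obtain z where z: "z \<in> C" using comp_nonempty by blast
    \<comment> \<open>By injectivity the vertex is its own only preimage, so it would lie in a
      component from \<open>\<A>\<close>.\<close>
    have "Inl (vertex_pt z) \<notin> h ` ?O"
    proof
      assume "Inl (vertex_pt z) \<in> h ` ?O"
      then obtain q where q: "q \<in> ?O" "h q = Inl (vertex_pt z)" by force
      have zV: "z \<in> verts G" using z comp_subset[OF C'] by blast
      then have "h (Inl (vertex_pt z)) = Inl (vertex_pt z)"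
        by (intro h(2)) (simp add: complex_pts_def induced_pts_def)
      moreover have "Inl (vertex_pt z) \<in> topspace (theta_G G)"
        unfolding theta_G_def by (rule vertex_pt_in_topspace[OF zV])
      moreover have "q \<in> topspace (theta_G G)" using q(1) openin_subset[OF O] by blast
      ultimately have "q = Inl (vertex_pt z)"
        using homeomorphic_imp_injective_map[OF h(1)] q(2) by (metis inj_onD)
      then have "Inl (vertex_pt z) \<in> ?O" using q(1) by simp
      then have "vertex_pt z \<in> induced_pts G (\<Union>{C \<in> comps G Y. \<A> \<in> principal_uf G Y C})"
        using vertex_pt_notin_inner_pts[of z G]
        by (auto simp: limit_nbhd_def Let_def induced_pts_def)
      then obtain C2 where "C2 \<in> comps G Y" "C2 \<in> \<A>" "z \<in> C2"
        unfolding vertex_pt_in_induced_pts_iff by (auto simp: principal_uf_def)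
      then show False using comps_eqI[OF C' _ z] C by blast
    qed
    then show "C \<in> {C \<in> comps_at G Y Y. \<not> (\<forall>z\<in>C. Inl (vertex_pt z) \<in> h ` ?O)}" using z C by blast
  qed
  ultimately show False using \<A>(3) finite_subset by blast
qed


section \<open>Finitely many components\<close>

text \<open>No \<open>comps_at G X Y\<close> is infinite, so there are no critical sets.\<close>

lemma FX_finite_comps:
  assumes "finite (comps G X)" shows "FX G X = principal_uf G X ` comps G X"
proof -
  have "finite (comps_at G X Y)" for Y
    using assms by (rule rev_finite_subset) (auto simp: comps_at_def)
  then show ?thesis by (simp add: FX_def crit_def)
qed

lemma UX_finite_comps:
  assumes fin: "finite (comps G X)" shows "UX G X = principal_uf G X ` comps G X"
proof (intro subset_antisym subsetI)
  fix U assume "U \<in> UX G X"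
  then have U: "ultrafilter_on (comps G X) U" by (simp add: UX_def)
  have "\<exists>C\<in>comps G X. {C} \<in> U"
  proof (rule ccontr)
    assume "\<not> ?thesis"
    then have co: "comps G X - {C} \<in> U" if "C \<in> comps G X" for C
      using U that unfolding ultrafilter_on_def by (metis empty_subsetI insert_subset)
    \<comment> \<open>If no singleton is in \<open>U\<close>, all their complements are;
      intersecting these finitely many sets puts the empty set into \<open>U\<close>.\<close>
    have "comps G X - T \<in> U" if "finite T" "T \<subseteq> comps G X" for T
      using that
    proof (induction T rule: finite_induct)
      case empty
      then show ?case using U by (simp add: ultrafilter_on_def)
    next
      case (insert C T)
      then have "(comps G X - T) \<inter> (comps G X - {C}) \<in> U"
        using U co by (simp add: ultrafilter_on_def)
      moreover have "(comps G X - T) \<inter> (comps G X - {C}) = comps G X - insert C T" by blast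
      ultimately show ?case by simp
    qed
    from this[OF fin] show False using U by (simp add: ultrafilter_on_def)
  qed
  then obtain C where C: "C \<in> comps G X" "{C} \<in> U" by blast
  have "U = principal_uf G X C"
  proof (intro subset_antisym subsetI)
    fix \<A> assume "\<A> \<in> U"
    then have "{C} \<inter> \<A> \<in> U" "\<A> \<subseteq> comps G X" using U C by (auto simp: ultrafilter_on_def)
    moreover have "{C} \<inter> \<A> \<noteq> {}" using U calculation(1) by (auto simp: ultrafilter_on_def)
    ultimately show "\<A> \<in> principal_uf G X C" by (simp add: principal_uf_def)
  next
    fix \<A> assume "\<A> \<in> principal_uf G X C"
    then have "{C} \<subseteq> \<A> \<and> \<A> \<subseteq> comps G X" by (simp add: principal_uf_def)
    then show "\<A> \<in> U" using U C(2) unfolding ultrafilter_on_def by blast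
  qed
  then show "U \<in> principal_uf G X ` comps G X" using C by blast
next
  fix U assume "U \<in> principal_uf G X ` comps G X"
  then show "U \<in> UX G X" by (auto simp: UX_def ultrafilter_on_def principal_uf_def)
qed

context
  fixes G :: "'a graph"
  assumes fin: "\<And>X. X \<in> fin_sets G \<Longrightarrow> finite (comps G X)"
begin

lemma UX_eq_FX: "X \<in> fin_sets G \<Longrightarrow> UX G X = FX G X"
  by (simp add: UX_finite_comps FX_finite_comps fin)

lemma UX_top_eq_FX_top: "X \<in> fin_sets G \<Longrightarrow> UX_top G X = FX_top G X"
  by (simp add: UX_top_def FX_top_def UX_eq_FX)

text \<open>All filters are principal here, and on those both bonding maps act through
  \<open>comp_map\<close>.\<close>

lemma U_map_eq_F_map: "X' \<in> fin_sets G \<Longrightarrow> x \<in> FX G X' \<Longrightarrow> U_map G X' X x = F_map G X' X x"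
  by (auto simp: FX_finite_comps fin U_map_principal F_map_principal)

lemma U_limit_eq_F_limit: "U_limit G = F_limit G"
proof -
  have "(\<Pi>\<^sub>E X\<in>fin_sets G. UX G X) = (\<Pi>\<^sub>E X\<in>fin_sets G. FX G X)"
    by (rule PiE_cong) (rule UX_eq_FX)
  then show ?thesis
    by (auto simp: U_limit_def F_limit_def inv_limit_def U_map_eq_F_map PiE_mem)
qed

text \<open>Each coordinate is principal at one component, and compatibility with
  \<open>F_map\<close> says exactly that these components form a direction.\<close>

lemma F_limit_eq_Omega: "F_limit G = Omega G"
proof (intro subset_antisym subsetI)
  fix \<xi> assume "\<xi> \<in> F_limit G"
  then have mem: "\<And>X. X \<in> fin_sets G \<Longrightarrow> \<xi> X \<in> principal_uf G X ` comps G X"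
    and ext: "\<xi> \<in> extensional (fin_sets G)"
    and lim: "\<And>X X'. X \<in> fin_sets G \<Longrightarrow> X' \<in> fin_sets G \<Longrightarrow> X \<subseteq> X' \<Longrightarrow> F_map G X' X (\<xi> X') = \<xi> X"
    by (auto simp: F_limit_def inv_limit_def PiE_iff FX_finite_comps fin)
  have "\<forall>X\<in>fin_sets G. \<exists>C\<in>comps G X. \<xi> X = principal_uf G X C" using mem by blast
  then obtain f where f: "\<And>X. X \<in> fin_sets G \<Longrightarrow> f X \<in> comps G X"
      "\<And>X. X \<in> fin_sets G \<Longrightarrow> \<xi> X = principal_uf G X (f X)"
    by metis
  have "f X' \<subseteq> f X" if X: "X \<in> fin_sets G" "X' \<in> fin_sets G" "X \<subseteq> X'" for X X'
  proof -
    have "principal_uf G X (f X) = principal_uf G X (comp_map G X' X (f X'))"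
      using lim[OF X] f X by (simp add: F_map_principal)
    then have "f X = comp_map G X' X (f X')" using f(1)[OF X(1)] principal_uf_inject by metis
    then show ?thesis
      using theI'[OF comps_super_ex[OF f(1)[OF X(2)] X(3)]] by (simp add: comp_map_def)
  qed
  then have "direction G f" using f by (simp add: direction_def)
  moreover have "\<xi> = (\<lambda>X\<in>fin_sets G. principal_uf G X (f X))"
    using ext f(2) by (auto simp: fun_eq_iff extensional_def)
  ultimately show "\<xi> \<in> Omega G" unfolding Omega_eq_directions by blast
next
  fix \<xi> assume "\<xi> \<in> Omega G"
  then obtain f where f: "direction G f" and \<xi>: "\<xi> = (\<lambda>X\<in>fin_sets G. principal_uf G X (f X))"
    unfolding Omega_eq_directions by blast
  have "F_map G X' X (\<xi> X') = \<xi> X" if X: "X \<in> fin_sets G" "X' \<in> fin_sets G" "X \<subseteq> X'" for X X'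
  proof -
    obtain v where "v \<in> f X'" using directionD(3)[OF f X(2)] by blast
    then have "comp_map G X' X (f X') = f X"
      using direction_mono[OF f X] directionD(1)[OF f] X by (intro comp_map_eq[of _ _ _ _ _ v]) auto
    then show ?thesis using X directionD(1)[OF f] by (simp add: \<xi> F_map_principal)
  qed
  then show "\<xi> \<in> F_limit G"
    using directionD(1)[OF f] by (auto simp: F_limit_def inv_limit_def FX_def \<xi>)
qed

text \<open>The two topologies are literally equal, so the identity serves as the
  homeomorphism.\<close>

lemma theta_G_eq_F_G: "theta_G G = F_G G"
proof -
  have "{limit_nbhd G L X Q | X Q. X \<in> fin_sets G \<and> openin (UX_top G X) Q} =
        {limit_nbhd G L X Q | X Q. X \<in> fin_sets G \<and> openin (FX_top G X) Q}" for L
    using UX_top_eq_FX_top by (metis (lifting))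
  then show ?thesis by (simp add: theta_G_def F_G_def ext_topology_def U_limit_eq_F_limit)
qed

lemma sys_equivalent_F_U: "sys_equivalent G (F_system G) (U_system G)"
  unfolding sys_equivalent_def F_system_def U_system_def sys_le.simps cpt_le_via.simps
  by (intro conjI exI[of _ "\<lambda>_ x. x"])
    (auto simp: UX_top_eq_FX_top topspace_FX_top U_map_eq_F_map)

end

text \<open>The four conditions are settled together: all hold if every \<open>comps G X\<close> is
  finite, and all fail otherwise.\<close>

theorem theorem5p4p11:
  fixes G :: "'a graph"
  assumes "simple_graph G" and "infinite (verts G)"
  shows "(Omega_cpt_equivalent G (theta_G G) (F_G G) \<longleftrightarrow>
            sys_equivalent G (F_system G) (U_system G)) \<and>
         (sys_equivalent G (F_system G) (U_system G) \<longleftrightarrow>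
            (\<forall>X\<in>fin_sets G. finite (comps G X))) \<and>
         ((\<forall>X\<in>fin_sets G. finite (comps G X)) \<longleftrightarrow>
            Omega G = F_limit G \<and> F_limit G = U_limit G)"
proof (cases "\<forall>X\<in>fin_sets G. finite (comps G X)")
  case True
  then have fin: "\<And>X. X \<in> fin_sets G \<Longrightarrow> finite (comps G X)" by blast
  have "Omega_cpt_equivalent G (theta_G G) (F_G G)"
    unfolding Omega_cpt_equivalent_def
    by (intro exI[of _ id]) (simp add: homeomorphic_map_id theta_G_eq_F_G[OF fin])
  then show ?thesis
    using True sys_equivalent_F_U[OF fin] F_limit_eq_Omega[OF fin] U_limit_eq_F_limit[OF fin] by simp
next
  case False
  then obtain Y where Y: "Y \<in> fin_sets G" "infinite (comps_at G Y Y)"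
    using critical_of_infinite_comps by blast
  then show ?thesis
    using False not_Omega_cpt_equivalent[OF assms(1) Y] not_U_system_le_F_system[OF Y]
      crit_pt_in_F_limit[OF Y] crit_pt_not_in_Omega[OF Y]
    by (auto simp: sys_equivalent_def)
qed

end
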